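(* For a finite non-abelian group $G$, the following statements are equivalent. (a) $\Pr(G)=\dfrac{1}{|G'|}\left(1+\dfrac{|G'|-1}{|G:Z(G)|}\right)$. (b) $\operatorname{cd}(G)=\{1,\,|G:Z(G)|^{1/2}\}$, which means that $G$ is of central type with $|\operatorname{cd}(G)|=2$. (c) $|\operatorname{Cl}_G(x)|=|G'|$ for all $x\in G-Z(G)$. (d) $\operatorname{Cl}_G(x)=G'x$ for all $x\in G-Z(G)$; in particular, $G$ is a nilpotent group of class $2$. (e) $C_G(x)\unlhd G$ and $G'\cong\frac{G}{C_G(x)}$ for all $x\in G-Z(G)$; in particular, $G$ is a CN-group, that is, the centralizer of every element is normal. (f) $G'=\{[y,x]: y\in G\}$ for all $x\in G-Z(G)$; in particular, every element of $G'$ is a commutator. (The "in particular" clauses are consequences of the respective conditions.)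
   Context: For a finite group $G$: $\Pr(G)=|\{(x,y)\in G\times G: xy=yx\}|/|G|^2$; $G'$ is the commutator subgroup; $Z(G)$ is the center; $[x,y]=xyx^{-1}y^{-1}$; $C_G(x)$ is the centralizer and $\operatorname{Cl}_G(x)$ the conjugacy class of $x$ in $G$. $\operatorname{Irr}(G)$ is the set of irreducible complex characters of $G$ and $\operatorname{cd}(G)=\{\chi(1):\chi\in\operatorname{Irr}(G)\}$. $G$ is of central type if $\chi(1)=|G:Z(G)|^{1/2}$ for some $\chi\in\operatorname{Irr}(G)$. *)

theory Defs
  imports
    Complex_Main
    "HOL-Algebra.Generated_Groups"
    "Jordan_Normal_Form.VS_Connect"
begin

definition commutator :: "('a, 'b) monoid_scheme \<Rightarrow> 'a \<Rightarrow> 'a \<Rightarrow> 'a" where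
  "commutator G x y = x \<otimes>\<^bsub>G\<^esub> y \<otimes>\<^bsub>G\<^esub> inv\<^bsub>G\<^esub> x \<otimes>\<^bsub>G\<^esub> inv\<^bsub>G\<^esub> y"

definition center :: "('a, 'b) monoid_scheme \<Rightarrow> 'a set" where
  "center G = {z \<in> carrier G. \<forall>g\<in>carrier G. z \<otimes>\<^bsub>G\<^esub> g = g \<otimes>\<^bsub>G\<^esub> z}"

definition centralizer :: "('a, 'b) monoid_scheme \<Rightarrow> 'a \<Rightarrow> 'a set" where
  "centralizer G x = {g \<in> carrier G. g \<otimes>\<^bsub>G\<^esub> x = x \<otimes>\<^bsub>G\<^esub> g}"

definition conj_class :: "('a, 'b) monoid_scheme \<Rightarrow> 'a \<Rightarrow> 'a set" where
  "conj_class G x = {g \<otimes>\<^bsub>G\<^esub> x \<otimes>\<^bsub>G\<^esub> inv\<^bsub>G\<^esub> g | g. g \<in> carrier G}"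

definition commutator_subgroup :: "('a, 'b) monoid_scheme \<Rightarrow> 'a set" where
  "commutator_subgroup G = derived G (carrier G)"

definition subgroup_index :: "('a, 'b) monoid_scheme \<Rightarrow> 'a set \<Rightarrow> nat" where
  "subgroup_index G H = card (rcosets\<^bsub>G\<^esub> H)"

definition commuting_probability :: "('a, 'b) monoid_scheme \<Rightarrow> real" where
  "commuting_probability G =
    real (card {(x, y) \<in> carrier G \<times> carrier G. x \<otimes>\<^bsub>G\<^esub> y = y \<otimes>\<^bsub>G\<^esub> x}) / (real (Coset.order G))\<^sup>2"

definition CN_group :: "('a, 'b) monoid_scheme \<Rightarrow> bool" where
  "CN_group G \<longleftrightarrow> group G \<and> (\<forall>x\<in>carrier G. centralizer G x \<lhd> G)"

text \<open>The indexing of the lower central series starts at 0: the term with index \<open>k\<close> is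
  usually written \<open>\<gamma>\<^sub>k\<^sub>+\<^sub>1(G)\<close>, so the nilpotency class is the least index of a trivial term.\<close>

primrec lower_central :: "('a, 'b) monoid_scheme \<Rightarrow> nat \<Rightarrow> 'a set" where
  "lower_central G 0 = carrier G"
| "lower_central G (Suc k) =
    generate G {commutator G x y | x y. x \<in> lower_central G k \<and> y \<in> carrier G}"

definition nilpotent_of_class :: "('a, 'b) monoid_scheme \<Rightarrow> nat \<Rightarrow> bool" where
  "nilpotent_of_class G c \<longleftrightarrow> group G \<and> lower_central G c = {\<one>\<^bsub>G\<^esub>} \<and>
    (\<forall>k<c. lower_central G k \<noteq> {\<one>\<^bsub>G\<^esub>})"

definition GL_complex :: "nat \<Rightarrow> complex mat monoid" where
  "GL_complex n = units_of (ring_mat TYPE(complex) n ())"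

definition irreducible_rep ::
    "('a, 'b) monoid_scheme \<Rightarrow> nat \<Rightarrow> ('a \<Rightarrow> complex mat) \<Rightarrow> bool" where
  "irreducible_rep G n \<rho> \<longleftrightarrow> n > 0 \<and> \<rho> \<in> hom G (GL_complex n) \<and>
    (\<forall>W. VectorSpace.subspace class_ring W (module_vec TYPE(complex) n) \<and>
         (\<forall>g\<in>carrier G. \<forall>w\<in>W. \<rho> g *\<^sub>v w \<in> W) \<longrightarrow>
         W = {0\<^sub>v n} \<or> W = carrier_vec n)"

definition mat_trace :: "complex mat \<Rightarrow> complex" where
  "mat_trace A = (\<Sum>i<dim_row A. A $$ (i, i))"

text \<open>Characters are made \<open>undefined\<close> outside the carrier, so that characters that agree on
  the group are equal as HOL functions.\<close>

definition Irr :: "('a, 'b) monoid_scheme \<Rightarrow> ('a \<Rightarrow> complex) set" where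
  "Irr G = {(\<lambda>g\<in>carrier G. mat_trace (\<rho> g)) | n \<rho>. irreducible_rep G n \<rho>}"

definition cd :: "('a, 'b) monoid_scheme \<Rightarrow> complex set" where
  "cd G = {\<chi> \<one>\<^bsub>G\<^esub> | \<chi>. \<chi> \<in> Irr G}"

definition central_type :: "('a, 'b) monoid_scheme \<Rightarrow> bool" where
  "central_type G \<longleftrightarrow>
    (\<exists>\<chi>\<in>Irr G. \<chi> \<one>\<^bsub>G\<^esub> = complex_of_real (sqrt (real (subgroup_index G (center G)))))"

end

theory Submission
  imports Defs "Jordan_Normal_Form.Spectral_Radius"
begin

text \<open>
  Conditions (a), (c), (d), (e) and (f) are compared by counting. Since \<open>y x y\<inverse> = [y, x] x\<close>, the class
  of \<open>x\<close> lies in the coset \<open>G' x\<close>, and equality holds iff \<open>G'\<close> consists of the commutators \<open>[y, x]\<close>. As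
  \<open>Pr(G)\<close> is the average of \<open>1 / |Cl(x)|\<close>, the value in (a) is the minimum forced by \<open>|Cl(x)| \<le> |G'|\<close>,
  attained iff every non-central class is a full coset of \<open>G'\<close>. In that case \<open>G'\<close> is central, and
  \<open>y \<mapsto> [y, x]\<close> is a homomorphism from \<open>G\<close> onto \<open>G'\<close> with kernel \<open>C(x)\<close>, which gives (e); conversely (e)
  gives \<open>|Cl(x)| = |G : C(x)| = |G'|\<close>.

  Condition (b) is compared with (d) by a small amount of character theory. Let \<open>\<rho>\<close> be an irreducible
  representation of degree \<open>n \<noteq> 1\<close> with character \<open>\<chi>\<close>. Row orthogonality
  (\<open>character_norm_off_center\<close>) and \<open>\<chi>(g\<inverse>) = cnj (\<chi>(g))\<close> (\<open>mat_trace_inv\<close>) give \<open>\<Sum> |\<chi>(g)|\<^sup>2 = |G| - |Z(G)| n\<^sup>2\<close>, the sum being over the non-central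
  \<open>g\<close>, so \<open>n\<^sup>2 = |G : Z(G)|\<close> iff \<open>\<chi>\<close> vanishes off the centre.

  If (d) holds and \<open>x\<close> is not central, some \<open>z = [y, x]\<close> acts by a scalar \<open>c \<noteq> 1\<close>, and
  \<open>\<chi>(x) = \<chi>(y x y\<inverse>) = \<chi>(z x) = c \<chi>(x)\<close> forces \<open>\<chi>(x) = 0\<close>. Conversely, if all \<open>\<chi>\<close> of degree other than 1
  vanish at \<open>x\<close>, then the normalized sums over \<open>Cl(x)\<close> and over \<open>G' x\<close> act in the same way in every
  irreducible representation. An element of the group algebra is determined by its images in the
  irreducible representations (\<open>irreducible_reps_separate\<close>), so the two sums are equal, which is
  (d). This separation property follows from the trace of the regular representation, as the trace
  of any representation is a sum of irreducible characters; it also supplies an irreducible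
  representation of degree other than 1.
\<close>

section \<open>Conjugacy classes, commutators and the commuting probability\<close>

context group
begin

lemma inv_mult_cancel [simp]:
  assumes "x \<in> carrier G" "y \<in> carrier G"
  shows "inv x \<otimes> (x \<otimes> y) = y" "x \<otimes> (inv x \<otimes> y) = y"
  using assms by (simp_all flip: m_assoc)

lemma subgroup_centralizer:
  assumes x: "x \<in> carrier G"
  shows "subgroup (centralizer G x) G"
proof (rule subgroupI)
  show "centralizer G x \<noteq> {}"
    unfolding centralizer_def using x by (auto intro!: exI[of _ \<one>])
  show "inv z \<in> centralizer G x" if "z \<in> centralizer G x" for z
    using that x unfolding centralizer_def
    by (auto simp: inv_solve_left inv_solve_right m_assoc)
  show "z \<otimes> w \<in> centralizer G x" if "z \<in> centralizer G x" "w \<in> centralizer G x" for z w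
  proof -
    have z: "z \<in> carrier G" "z \<otimes> x = x \<otimes> z" and w: "w \<in> carrier G" "w \<otimes> x = x \<otimes> w"
      using that unfolding centralizer_def by auto
    have "z \<otimes> w \<otimes> x = z \<otimes> x \<otimes> w" using x z(1) w by (simp add: m_assoc)
    also have "\<dots> = x \<otimes> (z \<otimes> w)" using x z w(1) by (simp add: m_assoc)
    finally show ?thesis using z(1) w(1) unfolding centralizer_def by simp
  qed
qed (auto simp: centralizer_def)

lemma center_eq_Inter: "center G = (\<Inter>x\<in>carrier G. centralizer G x)"
  unfolding center_def centralizer_def by auto

lemma subgroup_center: "subgroup (center G) G"
  unfolding center_eq_Inter by (rule subgroups_Inter) (use subgroup_centralizer in auto)

lemma commutator_closed [simp, intro]:
  "x \<in> carrier G \<Longrightarrow> y \<in> carrier G \<Longrightarrow> commutator G x y \<in> carrier G"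
  unfolding commutator_def by simp

lemma commutator_mult:
  assumes "x \<in> carrier G" "y \<in> carrier G"
  shows "commutator G x y \<otimes> (y \<otimes> x) = x \<otimes> y"
    and "commutator G x y \<otimes> y = x \<otimes> y \<otimes> inv x"
  using assms unfolding commutator_def by (simp_all add: m_assoc inv_solve_left)

lemma commutator_eq_one_iff:
  assumes "x \<in> carrier G" "y \<in> carrier G"
  shows "commutator G x y = \<one> \<longleftrightarrow> x \<otimes> y = y \<otimes> x"
  using assms commutator_mult(1)[OF assms] 
  by (metis commutator_closed l_one m_closed r_cancel_one)

lemma commutator_subgroup_eq_generate:
  "commutator_subgroup G = generate G {commutator G x y | x y. x \<in> carrier G \<and> y \<in> carrier G}"
  unfolding commutator_subgroup_def derived_def commutator_def
  by (rule arg_cong[of _ _ "generate G"]) blast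

lemma commutator_in_commutator_subgroup [intro]:
  "x \<in> carrier G \<Longrightarrow> y \<in> carrier G \<Longrightarrow> commutator G x y \<in> commutator_subgroup G"
  unfolding commutator_subgroup_eq_generate by (rule generate.incl) blast

lemma normal_commutator_subgroup: "commutator_subgroup G \<lhd> G"
  unfolding commutator_subgroup_def by (rule derived_self_is_normal)

lemma subgroup_commutator_subgroup: "subgroup (commutator_subgroup G) G"
  using normal_commutator_subgroup by (rule normal_imp_subgroup)

lemma commutator_subgroup_subset: "commutator_subgroup G \<subseteq> carrier G"
  using subgroup_commutator_subgroup by (rule subgroup.subset)

lemma conj_class_eq: "conj_class G x = (\<lambda>g. g \<otimes> x \<otimes> inv g) ` carrier G"
  unfolding conj_class_def by blast

lemma mem_conj_class: "x \<in> carrier G \<Longrightarrow> x \<in> conj_class G x"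
  unfolding conj_class_def by (auto intro!: exI[of _ \<one>])

lemma conj_class_eq_commutators:
  assumes x: "x \<in> carrier G"
  shows "conj_class G x = {commutator G y x | y. y \<in> carrier G} #> x"
proof -
  have "g \<otimes> x \<otimes> inv g = commutator G g x \<otimes> x" if "g \<in> carrier G" for g
    using commutator_mult(2)[OF that x] by simp
  then show ?thesis unfolding conj_class_eq r_coset_def by auto
qed

lemma conj_class_subset_coset:
  assumes x: "x \<in> carrier G"
  shows "conj_class G x \<subseteq> commutator_subgroup G #> x"
  unfolding conj_class_eq_commutators[OF x] r_coset_def using x by blast

lemma conj_class_eq_coset_iff:
  assumes x: "x \<in> carrier G"
  shows "conj_class G x = commutator_subgroup G #> x \<longleftrightarrow>
    commutator_subgroup G = {commutator G y x | y. y \<in> carrier G}"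
proof
  let ?K = "{commutator G y x | y. y \<in> carrier G}"
  have K: "?K \<subseteq> carrier G" using x by auto
  assume "conj_class G x = commutator_subgroup G #> x"
  then have "(?K #> x) #> inv x = (commutator_subgroup G #> x) #> inv x"
    unfolding conj_class_eq_commutators[OF x] by simp
  then show "commutator_subgroup G = ?K"
    using K commutator_subgroup_subset x by (simp add: coset_mult_assoc coset_mult_one)
next
  assume "commutator_subgroup G = {commutator G y x | y. y \<in> carrier G}"
  then show "conj_class G x = commutator_subgroup G #> x"
    unfolding conj_class_eq_commutators[OF x] by simp
qed

lemma card_coset_commutator_subgroup:
  "x \<in> carrier G \<Longrightarrow> card (commutator_subgroup G #> x) = card (commutator_subgroup G)"
  by (metis card_rcosets_equal commutator_subgroup_subset rcosetsI)

lemma card_subgroup_mult_index: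
  "finite (carrier G) \<Longrightarrow> subgroup H G \<Longrightarrow> card H * subgroup_index G H = Coset.order G"
  unfolding subgroup_index_def using lagrange_finite[of H] by (simp add: mult.commute)

text \<open>The orbit-stabilizer theorem for conjugation: the coset \<open>C(x) g\<close> and the conjugate
  \<open>g\<inverse> x g\<close> determine each other.\<close>

lemma index_centralizer:
  assumes x: "x \<in> carrier G"
  shows "subgroup_index G (centralizer G x) = card (conj_class G x)"
proof -
  let ?C = "centralizer G x"
  interpret C: subgroup ?C G by (rule subgroup_centralizer[OF x])
  have same: "?C #> g = ?C #> h \<longleftrightarrow> inv g \<otimes> x \<otimes> g = inv h \<otimes> x \<otimes> h"
    if g: "g \<in> carrier G" and h: "h \<in> carrier G" for g h
  proof -
    have "?C #> g = ?C #> h \<longleftrightarrow> g \<otimes> inv h \<in> ?C"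
      using g h C.subgroup_axioms
      by (metis C.rcos_module coset_join1 coset_join2 is_group rcos_self repr_independence C.subset)
    also have "\<dots> \<longleftrightarrow> g \<otimes> inv h \<otimes> x = x \<otimes> (g \<otimes> inv h)"
      using g h unfolding centralizer_def by simp
    also have "\<dots> \<longleftrightarrow> inv h \<otimes> x = inv g \<otimes> (x \<otimes> g \<otimes> inv h)"
      using g h x by (auto simp: m_assoc inv_solve_left)
    also have "\<dots> \<longleftrightarrow> inv h \<otimes> x = inv g \<otimes> x \<otimes> g \<otimes> inv h"
      using g h x by (simp add: m_assoc)
    also have "\<dots> \<longleftrightarrow> inv g \<otimes> x \<otimes> g = inv h \<otimes> x \<otimes> h"
      using g h x by (auto simp: inv_solve_right)
    finally show ?thesis .
  qed
  let ?f = "\<lambda>g. inv g \<otimes> x \<otimes> g"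
  have class_eq: "conj_class G x = ?f ` carrier G"
  proof -
    have "carrier G = (\<lambda>g. inv g) ` carrier G"
      by (metis (no_types, lifting) inv_closed inv_inv image_iff subsetI subset_antisym image_subsetI)
    then have "?f ` carrier G = ?f ` ((\<lambda>g. inv g) ` carrier G)" by simp
    also have "\<dots> = (\<lambda>g. g \<otimes> x \<otimes> inv g) ` carrier G"
      unfolding image_image by (rule image_cong) auto
    finally show ?thesis unfolding conj_class_eq by simp
  qed
  define F where "F K = ?f (SOME g. g \<in> carrier G \<and> K = ?C #> g)" for K
  have F: "F (?C #> g) = ?f g" if g: "g \<in> carrier G" for g
  proof -
    define h where "h = (SOME h. h \<in> carrier G \<and> ?C #> g = ?C #> h)"
    have "h \<in> carrier G \<and> ?C #> g = ?C #> h"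
      unfolding h_def by (rule someI[of _ g]) (use g in simp)
    then have "?f g = ?f h" using same[of g h] g by blast
    then show ?thesis unfolding F_def h_def by simp
  qed
  have R: "rcosets ?C = (\<lambda>g. ?C #> g) ` carrier G" unfolding RCOSETS_def by blast
  have "inj_on F (rcosets ?C)"
  proof (rule inj_onI)
    fix K L assume "K \<in> rcosets ?C" "L \<in> rcosets ?C" and eq: "F K = F L"
    then obtain g h where "g \<in> carrier G" "h \<in> carrier G" "K = ?C #> g" "L = ?C #> h"
      unfolding R by blast
    then show "K = L" using eq F[of g] F[of h] same[of g h] by simp
  qed
  moreover have "F ` (rcosets ?C) = conj_class G x"
    unfolding R class_eq image_image by (rule image_cong) (simp_all add: F)
  ultimately have "bij_betw F (rcosets ?C) (conj_class G x)" unfolding bij_betw_def ..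
  then show ?thesis unfolding subgroup_index_def by (rule bij_betw_same_card)
qed

lemma card_centralizer_mult_class:
  assumes fin: "finite (carrier G)" and x: "x \<in> carrier G"
  shows "card (centralizer G x) * card (conj_class G x) = Coset.order G"
  using card_subgroup_mult_index[OF fin subgroup_centralizer[OF x]] index_centralizer[OF x] by simp

lemma card_conj_class_eq_iff:
  assumes fin: "finite (carrier G)" and x: "x \<in> carrier G"
  shows "card (conj_class G x) = card (commutator_subgroup G) \<longleftrightarrow>
    conj_class G x = commutator_subgroup G #> x"
proof
  assume "card (conj_class G x) = card (commutator_subgroup G)"
  moreover have "finite (commutator_subgroup G #> x)"
    using fin x commutator_subgroup_subset by (meson finite_subset r_coset_subset_G)
  ultimately show "conj_class G x = commutator_subgroup G #> x"
    using conj_class_subset_coset[OF x] card_coset_commutator_subgroup[OF x]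
    by (metis card_subset_eq)
qed (simp add: card_coset_commutator_subgroup[OF x])

lemma conj_class_central: 
  assumes "x \<in> center G" shows "conj_class G x = {x}"
proof -
  have "g \<otimes> x \<otimes> inv g = x" if g: "g \<in> carrier G" for g
  proof -
    have x: "x \<in> carrier G" and "g \<otimes> x = x \<otimes> g" using assms g unfolding center_def by auto
    then show ?thesis using g by (simp add: m_assoc)
  qed
  then show ?thesis unfolding conj_class_eq by auto
qed

text \<open>Counting commuting pairs gives \<open>Pr(G) = |G|\<inverse> \<Sum>\<^sub>x |Cl(x)|\<inverse>\<close>.\<close>

lemma commuting_probability_eq_sum:
  assumes fin: "finite (carrier G)"
  shows "commuting_probability G =
    (\<Sum>x\<in>carrier G. 1 / real (card (conj_class G x))) / real (Coset.order G)"
proof -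
  have pos: "Coset.order G > 0" using fin by (simp add: order_gt_0_iff_finite)
  have "{(x, y) \<in> carrier G \<times> carrier G. x \<otimes> y = y \<otimes> x} =
      (SIGMA x:carrier G. centralizer G x)"
    unfolding centralizer_def by auto
  then have "real (card {(x, y) \<in> carrier G \<times> carrier G. x \<otimes> y = y \<otimes> x}) =
      (\<Sum>x\<in>carrier G. real (card (centralizer G x)))"
    using fin by (simp add: card_SigmaI centralizer_def)
  also have "\<dots> = (\<Sum>x\<in>carrier G. real (Coset.order G) * (1 / real (card (conj_class G x))))"
  proof (rule sum.cong)
    fix x assume x: "x \<in> carrier G"
    have eq: "real (card (centralizer G x)) * real (card (conj_class G x)) = real (Coset.order G)"
      using card_centralizer_mult_class[OF fin x] by (metis of_nat_mult)
    then have "real (card (centralizer G x)) * real (card (conj_class G x)) \<noteq> 0" using pos by simp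
    then have "real (card (conj_class G x)) \<noteq> 0" by (metis mult_zero_right)
    then show "real (card (centralizer G x)) = real (Coset.order G) * (1 / real (card (conj_class G x)))"
      using eq by (simp add: field_simps)
  qed simp
  also have "\<dots> = real (Coset.order G) * (\<Sum>x\<in>carrier G. 1 / real (card (conj_class G x)))"
    by (simp add: sum_distrib_left)
  finally show ?thesis
    unfolding commuting_probability_def using pos by (simp add: power2_eq_square)
qed

text \<open>Every class has at most \<open>|G'|\<close> elements, so the sum over the non-central elements is at
  least \<open>|G - Z(G)| / |G'|\<close>, with equality exactly if all these classes have \<open>|G'|\<close> elements.\<close>

lemma commuting_probability_eq_iff:
  assumes fin: "finite (carrier G)"
  defines "D \<equiv> commutator_subgroup G"
  shows "commuting_probability G =
      1 / real (card D) * (1 + (real (card D) - 1) / real (subgroup_index G (center G))) \<longleftrightarrow>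
    (\<forall>x\<in>carrier G - center G. card (conj_class G x) = card D)"
proof -
  let ?Z = "center G" and ?i = "subgroup_index G (center G)"
  let ?c = "\<lambda>x. 1 / real (card (conj_class G x))"
  have pos: "Coset.order G > 0" using fin by (simp add: order_gt_0_iff_finite)
  have Zsub: "?Z \<subseteq> carrier G" unfolding center_def by blast
  have finD: "finite D" and D0: "card D > 0"
  proof -
    show "finite D" unfolding D_def using fin commutator_subgroup_subset finite_subset by blast
    then show "card D > 0"
      unfolding D_def using subgroup.one_closed[OF subgroup_commutator_subgroup]
      by (auto simp: card_gt_0_iff)
  qed
  have ZI: "real (card ?Z) * real ?i = real (Coset.order G)"
    using card_subgroup_mult_index[OF fin subgroup_center] by (metis of_nat_mult)
  then have "real (card ?Z) * real ?i \<noteq> 0" using pos by simp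
  then have i0: "real ?i \<noteq> 0" and Z0: "real (card ?Z) \<noteq> 0" by auto
  have cls: "card (conj_class G x) > 0" "card (conj_class G x) \<le> card D"
    if x: "x \<in> carrier G" for x
  proof -
    have finite: "finite (D #> x)"
      unfolding D_def using fin x commutator_subgroup_subset by (meson finite_subset r_coset_subset_G)
    then show "card (conj_class G x) \<le> card D"
      using conj_class_subset_coset[OF x] card_coset_commutator_subgroup[OF x]
      unfolding D_def by (metis card_mono)
    show "card (conj_class G x) > 0"
      using mem_conj_class[OF x] finite conj_class_subset_coset[OF x] unfolding D_def
      by (metis card_gt_0_iff empty_iff finite_subset)
  qed
  have "(\<Sum>x\<in>carrier G. ?c x) = (\<Sum>x\<in>?Z. ?c x) + (\<Sum>x\<in>carrier G - ?Z. ?c x)"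
    using sum.subset_diff[OF Zsub fin] by (simp add: add.commute)
  moreover have "(\<Sum>x\<in>?Z. ?c x) = real (card ?Z)" by (simp add: conj_class_central)
  moreover have "(\<Sum>x\<in>carrier G - ?Z. ?c x) =
      (\<Sum>x\<in>carrier G - ?Z. ?c x - 1 / real (card D)) + real (card (carrier G - ?Z)) / real (card D)"
    by (simp add: sum_subtractf)
  moreover have "real (card (carrier G - ?Z)) = real (Coset.order G) - real (card ?Z)"
    using fin Zsub unfolding Coset.order_def
    by (simp add: card_Diff_subset finite_subset of_nat_diff card_mono)
  ultimately have lhs: "commuting_probability G =
      (real (card ?Z) + ((\<Sum>x\<in>carrier G - ?Z. ?c x - 1 / real (card D)) +
        (real (Coset.order G) - real (card ?Z)) / real (card D))) / real (Coset.order G)"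
    unfolding commuting_probability_eq_sum[OF fin] by simp
  have rhs: "1 / real (card D) * (1 + (real (card D) - 1) / real ?i) =
      (real (card ?Z) + (real (Coset.order G) - real (card ?Z)) / real (card D)) / real (Coset.order G)"
    using D0 i0 Z0 unfolding ZI[symmetric] by (simp add: field_simps)
  have "commuting_probability G =
      1 / real (card D) * (1 + (real (card D) - 1) / real ?i) \<longleftrightarrow>
    (\<Sum>x\<in>carrier G - ?Z. ?c x - 1 / real (card D)) = 0"
    unfolding lhs rhs using pos by simp
  also have "\<dots> \<longleftrightarrow> (\<forall>x\<in>carrier G - ?Z. ?c x - 1 / real (card D) = 0)"
    by (rule sum_nonneg_eq_0_iff) (use fin cls in \<open>auto simp: frac_le\<close>)
  also have "\<dots> \<longleftrightarrow> (\<forall>x\<in>carrier G - ?Z. card (conj_class G x) = card D)"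
  proof (rule ball_cong)
    fix x assume "x \<in> carrier G - ?Z"
    then show "?c x - 1 / real (card D) = 0 \<longleftrightarrow> card (conj_class G x) = card D"
      using cls(1)[of x] D0 by (auto simp: field_simps)
  qed simp
  finally show ?thesis .
qed

text \<open>A non-central \<open>z\<close> in \<open>G'\<close> would have the class \<open>G' z = G'\<close>, which contains \<open>\<one>\<close>.\<close>

lemma commutator_subgroup_central:
  assumes "\<And>x. x \<in> carrier G - center G \<Longrightarrow> conj_class G x = commutator_subgroup G #> x"
  shows "commutator_subgroup G \<subseteq> center G"
proof
  fix z assume z: "z \<in> commutator_subgroup G"
  then have zG: "z \<in> carrier G" using commutator_subgroup_subset by blast
  show "z \<in> center G"
  proof (rule ccontr)
    assume "z \<notin> center G"
    then have "conj_class G z = commutator_subgroup G"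
      using assms[of z] zG coset_join2[OF zG subgroup_commutator_subgroup z] by simp
    then have "\<one> \<in> conj_class G z"
      using subgroup.one_closed[OF subgroup_commutator_subgroup] by simp
    then obtain g where g: "g \<in> carrier G" "\<one> = g \<otimes> z \<otimes> inv g"
      unfolding conj_class_def by blast
    then have "g \<otimes> z = g" using zG by (metis inv_closed inv_equality inv_inv m_closed)
    then have "z = \<one>" using g zG by (metis l_cancel_one)
    then show False using \<open>z \<notin> center G\<close> unfolding center_def by simp
  qed
qed

text \<open>If \<open>G'\<close> is central, \<open>[y z, x] = y [z, x] x y\<inverse> x\<inverse> = [y, x] [z, x]\<close>.\<close>

lemma commutator_hom:
  assumes x: "x \<in> carrier G" and cen: "commutator_subgroup G \<subseteq> center G"
  shows "(\<lambda>y. commutator G y x) \<in> hom G (G\<lparr>carrier := commutator_subgroup G\<rparr>)"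
proof (rule homI)
  fix y z assume y: "y \<in> carrier G" and z: "z \<in> carrier G"
  let ?c = "commutator G z x"
  have c: "?c \<in> carrier G" "\<And>g. g \<in> carrier G \<Longrightarrow> ?c \<otimes> g = g \<otimes> ?c"
    using cen x z commutator_in_commutator_subgroup[OF z x] unfolding center_def by auto
  have "commutator G (y \<otimes> z) x = y \<otimes> (z \<otimes> x \<otimes> inv z) \<otimes> inv y \<otimes> inv x"
    using x y z unfolding commutator_def by (simp add: m_assoc inv_mult_group)
  also have "\<dots> = y \<otimes> (?c \<otimes> x) \<otimes> inv y \<otimes> inv x"
    using commutator_mult(2)[OF z x] by simp
  also have "\<dots> = (y \<otimes> ?c) \<otimes> (x \<otimes> inv y \<otimes> inv x)"
    using c(1) x y by (simp add: m_assoc)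
  also have "\<dots> = ?c \<otimes> commutator G y x"
    using c(1) x y unfolding c(2)[OF y, symmetric] commutator_def[of G y] by (simp add: m_assoc)
  also have "\<dots> = commutator G y x \<otimes> ?c" using c(2) x y by simp
  finally show "commutator G (y \<otimes> z) x =
      commutator G y x \<otimes>\<^bsub>G\<lparr>carrier := commutator_subgroup G\<rparr>\<^esub> ?c" by simp
qed (use x in auto)

lemma commutator_subgroup_iso_centralizer_quotient:
  assumes x: "x \<in> carrier G" and cen: "commutator_subgroup G \<subseteq> center G"
    and comms: "commutator_subgroup G = {commutator G y x | y. y \<in> carrier G}"
  shows "centralizer G x \<lhd> G"
    and "G\<lparr>carrier := commutator_subgroup G\<rparr> \<cong> G Mod (centralizer G x)"
proof -
  let ?D = "G\<lparr>carrier := commutator_subgroup G\<rparr>" and ?h = "\<lambda>y. commutator G y x"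
  interpret h: group_hom G ?D ?h
    using commutator_hom[OF x cen] subgroup_imp_group[OF subgroup_commutator_subgroup]
    by (simp add: group_hom_def group_hom_axioms_def is_group)
  have ker: "kernel G ?D ?h = centralizer G x"
    unfolding kernel_def centralizer_def using x by (auto simp: commutator_eq_one_iff)
  show "centralizer G x \<lhd> G" using h.normal_kernel unfolding ker .
  have "?h ` carrier G = carrier ?D" using comms by auto
  from h.FactGroup_iso[OF this] show "?D \<cong> G Mod (centralizer G x)"
    unfolding ker using group.iso_sym normal.factorgroup_is_group[OF \<open>centralizer G x \<lhd> G\<close>] by blast
qed

lemma nilpotent_of_class_2:
  assumes nc: "\<not> comm_group G" and cen: "commutator_subgroup G \<subseteq> center G"
  shows "nilpotent_of_class G 2"
proof -
  obtain x y where xy: "x \<in> carrier G" "y \<in> carrier G" "x \<otimes> y \<noteq> y \<otimes> x"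
    using nc group_comm_groupI by blast
  have one: "lower_central G (Suc 0) = commutator_subgroup G"
    unfolding commutator_subgroup_eq_generate by simp
  have c1: "commutator G d g = \<one>" if "d \<in> commutator_subgroup G" "g \<in> carrier G" for d g
    using that cen commutator_eq_one_iff[of d g] unfolding center_def by blast
  have "{commutator G d g | d g. d \<in> commutator_subgroup G \<and> g \<in> carrier G} = {\<one>}"
  proof
    show "{\<one>} \<subseteq> {commutator G d g | d g. d \<in> commutator_subgroup G \<and> g \<in> carrier G}"
      using c1[OF subgroup.one_closed[OF subgroup_commutator_subgroup] one_closed, symmetric]
        subgroup.one_closed[OF subgroup_commutator_subgroup] one_closed by blast
  qed (use c1 in blast)
  then have two: "lower_central G (Suc (Suc 0)) = {\<one>}"
    using one by (simp add: generate_one)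
  have "commutator_subgroup G \<noteq> {\<one>}"
    using commutator_in_commutator_subgroup[OF xy(1,2)] commutator_eq_one_iff[OF xy(1,2)] xy(3) by auto
  moreover have "carrier G \<noteq> {\<one>}" using xy by auto
  ultimately show ?thesis
    unfolding nilpotent_of_class_def using two one by (auto simp: numeral_2_eq_2 less_Suc_eq is_group)
qed

end

section \<open>Bases adapted to a subspace, traces and sums of matrices\<close>

text \<open>A basis of a proper non-zero subspace \<open>W\<close> is extended to one of the whole space. The columns of \<open>P\<close>
  are this basis, the first \<open>m\<close> of them in \<open>W\<close>, and \<open>Q\<close> computes the coordinates.\<close>

lemma (in vec_space) adapted_basis:
  assumes W: "VectorSpace.subspace class_ring W (module_vec TYPE('a) n)"
    and W0: "W \<noteq> {0\<^sub>v n}" and W1: "W \<noteq> carrier_vec n"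
  obtains m P Q where "0 < m" "m < n" "P \<in> carrier_mat n n" "Q \<in> carrier_mat n n"
    "P * Q = 1\<^sub>m n" "Q * P = 1\<^sub>m n" "\<And>j. j < m \<Longrightarrow> col P j \<in> W"
    "\<And>w i. w \<in> W \<Longrightarrow> m \<le> i \<Longrightarrow> i < n \<Longrightarrow> (Q *\<^sub>v w) $ i = 0"
proof -
  have sub: "submodule class_ring W (module_vec TYPE('a) n)" by (rule subspace.submod[OF W])
  have Wc: "W \<subseteq> carrier_vec n" using submodule.subset[OF sub] by simp
  have bound: "finite S \<and> card S \<le> n" if "S \<subseteq> carrier_vec n" "lin_indpt S" for S
    using li_le_dim[of S] that dim_is_n by simp
  have empty: "lin_indpt {}" unfolding lin_dep_def by auto
  have "\<exists>A. finite A \<and> maximal A (\<lambda>S. S \<subseteq> W \<and> lin_indpt S)"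
    by (rule maximal_exists[of _ n "{}"]) (use bound Wc empty in auto)
  then obtain A where A: "maximal A (\<lambda>S. S \<subseteq> W \<and> lin_indpt S)" by (elim exE conjE)
  then have AW: "A \<subseteq> W" and Ali: "lin_indpt A" unfolding maximal_def by auto
  have WA: "W = span A"
  proof
    show "span A \<subseteq> W" by (rule span_is_subset[OF AW sub])
    show "W \<subseteq> span A"
    proof
      fix w assume w: "w \<in> W"
      show "w \<in> span A"
      proof (rule ccontr)
        assume not: "w \<notin> span A"
        then have "w \<notin> A" using in_own_span[of A] AW Wc by auto
        then have "lin_indpt (A \<union> {w})"
          using lin_dep_iff_in_span[of A w] AW Wc Ali w not by auto
        then have "A \<union> {w} = A" using A w AW unfolding maximal_def by blast
        then show False using \<open>w \<notin> A\<close> by blast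
      qed
    qed
  qed
  have "\<exists>B. finite B \<and> maximal B (\<lambda>S. A \<subseteq> S \<and> S \<subseteq> carrier_vec n \<and> lin_indpt S)"
    by (rule maximal_exists[of _ n A]) (use bound Wc AW Ali in auto)
  then obtain B where B: "maximal B (\<lambda>S. A \<subseteq> S \<and> S \<subseteq> carrier_vec n \<and> lin_indpt S)"
    by (elim exE conjE)
  then have AB: "A \<subseteq> B" and Bc: "B \<subseteq> carrier_vec n" and Bli: "lin_indpt B"
    unfolding maximal_def by auto
  have "C = B" if "B \<subseteq> C \<and> C \<subseteq> carrier V \<and> lin_indpt C" for C
  proof -
    have "A \<subseteq> C \<and> C \<subseteq> carrier_vec n \<and> lin_indpt C"
      using that subset_trans[OF AB] by simp
    then show ?thesis using B that unfolding maximal_def by simp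
  qed
  then have "maximal B (\<lambda>S. S \<subseteq> carrier_vec n \<and> lin_indpt S)"
    unfolding maximal_def using Bc Bli by simp
  then have Bgen: "span B = carrier_vec n" using max_li_is_gen[of B] by simp
  have finB: "finite B" using bound Bc Bli by blast
  then have finA: "finite A" using AB finite_subset by blast
  have "basis B" unfolding basis_def using Bli Bgen Bc by simp
  then have cardB: "card B = n" using dim_basis[OF finB] dim_is_n by simp
  obtain xs where xs: "set xs = A" "distinct xs" using finite_distinct_list[OF finA] by blast
  obtain ys where ys: "set ys = B - A" "distinct ys"
    using finite_distinct_list[of "B - A"] finB by blast
  let ?m = "length xs" and ?zs = "xs @ ys"
  have zs: "set ?zs = B" "distinct ?zs" using xs ys AB by auto
  then have len: "length ?zs = n" using cardB distinct_card by metis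
  let ?P = "mat_of_cols n ?zs"
  have P: "?P \<in> carrier_mat n n" using len by (metis mat_of_cols_carrier(1))
  have comb: "\<exists>c. v = mat_of_cols n us *\<^sub>v vec (length us) c"
    if us: "set us \<subseteq> carrier_vec n" and v: "v \<in> span (set us)" for us v
  proof -
    have "v \<in> span_list us" using v span_list_as_span[OF us] by simp
    then obtain c where "v = lincomb_list c us" by (rule in_span_listE)
    moreover have "\<forall>u \<in> set us. dim_vec u = n" using us by auto
    ultimately show ?thesis using lincomb_list_as_mat_mult by blast
  qed
  have "\<exists>c. unit_vec n j = ?P *\<^sub>v vec n c" for j
    using comb[of ?zs "unit_vec n j"] Bc Bgen len unfolding zs(1) by simp
  then obtain c where c: "\<And>j. unit_vec n j = ?P *\<^sub>v vec n (c j)" by metis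
  let ?Q = "mat n n (\<lambda>(i, j). c j i)"
  have Q: "?Q \<in> carrier_mat n n" by simp
  have PQ: "?P * ?Q = 1\<^sub>m n"
  proof (rule mat_col_eqI)
    fix j assume "j < dim_col (1\<^sub>m n :: 'a mat)"
    then have j: "j < n" by simp
    have "col ?Q j = vec n (c j)" using j by (intro eq_vecI) auto
    then show "col (?P * ?Q) j = col (1\<^sub>m n) j"
      using j c[of j] col_mult2[OF P Q j] by simp
  qed (use P in auto)
  have QP: "?Q * ?P = 1\<^sub>m n" by (rule mat_mult_left_right_inverse[OF P Q PQ])
  show ?thesis
  proof (rule that[OF _ _ P Q PQ QP])
    show "0 < ?m"
    proof (rule ccontr)
      assume "\<not> 0 < ?m"
      then have "A = {}" using xs by simp
      then show False using WA W0 span_empty by simp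
    qed
    show "?m < n"
    proof (rule ccontr)
      assume "\<not> ?m < n"
      then have "ys = []" using len by (cases ys) auto
      then have "A = B" using xs zs by simp
      then show False using WA W1 Bgen by simp
    qed
    show "col ?P j \<in> W" if "j < ?m" for j
    proof -
      have x: "xs ! j \<in> W" using that xs AW by auto
      then show ?thesis using that Wc by (simp add: nth_append subset_iff)
    qed
    fix w i assume w: "w \<in> W" and i: "?m \<le> i" "i < n"
    obtain d where d: "w = mat_of_cols n xs *\<^sub>v vec ?m d"
      using comb[of xs w] xs AW Wc WA w by auto
    let ?d = "vec n (\<lambda>k. if k < ?m then d k else 0)"
    have "w = ?P *\<^sub>v ?d"
    proof (rule eq_vecI)
      fix k assume "k < dim_vec (?P *\<^sub>v ?d)"
      then have k: "k < n" by simp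
      have "(\<Sum>l<n. ?P $$ (k, l) * (if l < ?m then d l else 0)) = (\<Sum>l<?m. mat_of_cols n xs $$ (k, l) * d l)"
        by (rule sum.mono_neutral_cong_right)
          (use k len in \<open>auto simp: mat_of_cols_index nth_append\<close>)
      then show "w $ k = (?P *\<^sub>v ?d) $ k"
        unfolding d using k len
        by (simp add: scalar_prod_def lessThan_atLeast0)
    qed (simp add: d)
    then have "?Q *\<^sub>v w = ?Q * ?P *\<^sub>v ?d"
      using P Q by (simp add: assoc_mult_mat_vec[of _ n n _ n])
    then show "(?Q *\<^sub>v w) $ i = 0" unfolding QP using i by simp
  qed
qed

lemma mat_mult_index:
  assumes "A \<in> carrier_mat n m" "B \<in> carrier_mat m p" "i < n" "j < p"
  shows "(A * B) $$ (i, j) = (\<Sum>k<m. A $$ (i, k) * B $$ (k, j))"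
  using assms by (simp add: scalar_prod_def lessThan_atLeast0)

lemma mat_trace_carrier: "A \<in> carrier_mat n n \<Longrightarrow> mat_trace A = (\<Sum>i<n. A $$ (i, i))"
  unfolding mat_trace_def by simp

lemma mat_trace_one: "mat_trace (1\<^sub>m n) = of_nat n"
  unfolding mat_trace_def by simp

lemma mat_trace_smult: "A \<in> carrier_mat n n \<Longrightarrow> mat_trace (c \<cdot>\<^sub>m A) = c * mat_trace A"
  unfolding mat_trace_def by (simp add: sum_distrib_left)

lemma mat_trace_comm:
  assumes A: "A \<in> carrier_mat n m" and B: "B \<in> carrier_mat m n"
  shows "mat_trace (A * B) = mat_trace (B * A)"
proof -
  have "mat_trace (A * B) = (\<Sum>i<n. \<Sum>k<m. A $$ (i, k) * B $$ (k, i))"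
    using A B by (simp add: mat_trace_def mat_mult_index[OF A B] del: index_mult_mat(1))
  also have "\<dots> = (\<Sum>k<m. \<Sum>i<n. B $$ (k, i) * A $$ (i, k))"
    by (subst sum.swap) (simp add: mult.commute)
  also have "\<dots> = mat_trace (B * A)"
    using A B by (simp add: mat_trace_def mat_mult_index[OF B A] del: index_mult_mat(1))
  finally show ?thesis .
qed

lemma mat_trace_conj:
  assumes A: "A \<in> carrier_mat n n" and P: "P \<in> carrier_mat n n" and Q: "Q \<in> carrier_mat n n"
    and PQ: "P * Q = 1\<^sub>m n"
  shows "mat_trace (Q * A * P) = mat_trace A"
proof -
  have "mat_trace (Q * A * P) = mat_trace (P * (Q * A))"
    using A P Q by (intro mat_trace_comm) auto
  also have "P * (Q * A) = A"
    using A P Q PQ by (simp flip: assoc_mult_mat[of P n n Q n A n])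
  finally show ?thesis .
qed

text \<open>The sum of a family of \<open>n \<times> n\<close> matrices, formed entrywise: the dimension is a parameter
  because it cannot be read off an empty family.\<close>

definition mat_sum :: "nat \<Rightarrow> ('i \<Rightarrow> 'a :: comm_ring_1 mat) \<Rightarrow> 'i set \<Rightarrow> 'a mat" where
  "mat_sum n f S = mat n n (\<lambda>(i, j). \<Sum>s\<in>S. f s $$ (i, j))"

lemma mat_sum_carrier [simp]: "mat_sum n f S \<in> carrier_mat n n"
  unfolding mat_sum_def by simp

lemma mat_sum_index: "i < n \<Longrightarrow> j < n \<Longrightarrow> mat_sum n f S $$ (i, j) = (\<Sum>s\<in>S. f s $$ (i, j))"
  unfolding mat_sum_def by simp

lemma mat_sum_cong: "(\<And>s. s \<in> S \<Longrightarrow> f s = g s) \<Longrightarrow> mat_sum n f S = mat_sum n g S"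
  unfolding mat_sum_def by simp

lemma mat_sum_reindex: "bij_betw h S T \<Longrightarrow> mat_sum n (\<lambda>s. f (h s)) S = mat_sum n f T"
  unfolding mat_sum_def by (simp add: sum.reindex_bij_betw[of h S T "\<lambda>s. f s $$ _"])

lemma mat_sum_mult_left:
  assumes "A \<in> carrier_mat n n" "\<And>s. s \<in> S \<Longrightarrow> f s \<in> carrier_mat n n"
  shows "A * mat_sum n f S = mat_sum n (\<lambda>s. A * f s) S"
proof (rule eq_matI)
  fix i j assume "i < dim_row (mat_sum n (\<lambda>s. A * f s) S)" "j < dim_col (mat_sum n (\<lambda>s. A * f s) S)"
  then have ij: "i < n" "j < n" by (simp_all add: mat_sum_def)
  have "(A * mat_sum n f S) $$ (i, j) = (\<Sum>k<n. \<Sum>s\<in>S. A $$ (i, k) * f s $$ (k, j))"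
    using ij assms(1) by (simp add: mat_mult_index[of _ n n _ n] mat_sum_index sum_distrib_left)
  also have "\<dots> = (\<Sum>s\<in>S. (A * f s) $$ (i, j))"
    using ij assms by (subst sum.swap) (simp add: mat_mult_index[of _ n n _ n])
  finally show "(A * mat_sum n f S) $$ (i, j) = mat_sum n (\<lambda>s. A * f s) S $$ (i, j)"
    using ij by (simp add: mat_sum_index)
qed (use assms in \<open>auto simp: mat_sum_def\<close>)

lemma mat_sum_mult_right:
  assumes "A \<in> carrier_mat n n" "\<And>s. s \<in> S \<Longrightarrow> f s \<in> carrier_mat n n"
  shows "mat_sum n f S * A = mat_sum n (\<lambda>s. f s * A) S"
proof (rule eq_matI)
  fix i j assume "i < dim_row (mat_sum n (\<lambda>s. f s * A) S)" "j < dim_col (mat_sum n (\<lambda>s. f s * A) S)"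
  then have ij: "i < n" "j < n" by (simp_all add: mat_sum_def)
  have "(mat_sum n f S * A) $$ (i, j) = (\<Sum>k<n. \<Sum>s\<in>S. f s $$ (i, k) * A $$ (k, j))"
    using ij assms(1) by (simp add: mat_mult_index[of _ n n _ n] mat_sum_index sum_distrib_right)
  also have "\<dots> = (\<Sum>s\<in>S. (f s * A) $$ (i, j))"
    using ij assms by (subst sum.swap) (simp add: mat_mult_index[of _ n n _ n])
  finally show "(mat_sum n f S * A) $$ (i, j) = mat_sum n (\<lambda>s. f s * A) S $$ (i, j)"
    using ij by (simp add: mat_sum_index)
qed (use assms in \<open>auto simp: mat_sum_def\<close>)

lemma mat_trace_mat_sum:
  assumes "\<And>s. s \<in> S \<Longrightarrow> f s \<in> carrier_mat n n"
  shows "mat_trace (mat_sum n f S) = (\<Sum>s\<in>S. mat_trace (f s))"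
proof -
  have "mat_trace (mat_sum n f S) = (\<Sum>i<n. \<Sum>s\<in>S. f s $$ (i, i))"
    by (simp add: mat_trace_carrier[of _ n] mat_sum_index)
  also have "\<dots> = (\<Sum>s\<in>S. mat_trace (f s))"
    using assms by (subst sum.swap) (auto simp: mat_trace_carrier[of _ n] intro!: sum.cong)
  finally show ?thesis .
qed

section \<open>Representations and Schur's lemma\<close>

text \<open>A matrix representation of degree \<open>n\<close>, not necessarily irreducible and possibly of degree 0.
  The values outside the carrier are arbitrary.\<close>

definition matrix_rep :: "('a, 'b) monoid_scheme \<Rightarrow> nat \<Rightarrow> ('a \<Rightarrow> complex mat) \<Rightarrow> bool" where
  "matrix_rep G n \<rho> \<longleftrightarrow> (\<forall>g\<in>carrier G. \<rho> g \<in> carrier_mat n n) \<and> \<rho> \<one>\<^bsub>G\<^esub> = 1\<^sub>m n \<and>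
    (\<forall>g\<in>carrier G. \<forall>h\<in>carrier G. \<rho> (g \<otimes>\<^bsub>G\<^esub> h) = \<rho> g * \<rho> h)"

lemma matrix_repD:
  assumes "matrix_rep G n \<rho>"
  shows matrix_rep_carrier: "g \<in> carrier G \<Longrightarrow> \<rho> g \<in> carrier_mat n n"
    and matrix_rep_one: "\<rho> \<one>\<^bsub>G\<^esub> = 1\<^sub>m n"
    and matrix_rep_mult: "g \<in> carrier G \<Longrightarrow> h \<in> carrier G \<Longrightarrow> \<rho> (g \<otimes>\<^bsub>G\<^esub> h) = \<rho> g * \<rho> h"
  using assms unfolding matrix_rep_def by auto

lemma group_GL_complex: "group (GL_complex n)"
proof -
  interpret ring "ring_mat TYPE(complex) n ()" by (rule ring_mat)
  show ?thesis unfolding GL_complex_def by (rule units_group)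
qed

lemma carrier_GL_complex:
  "carrier (GL_complex n) = {A \<in> carrier_mat n n. \<exists>B\<in>carrier_mat n n. B * A = 1\<^sub>m n \<and> A * B = 1\<^sub>m n}"
  unfolding GL_complex_def units_of_carrier Units_def ring_mat_simps ..

lemma matrix_rep_iff_hom:
  assumes "group G"
  shows "\<rho> \<in> hom G (GL_complex n) \<longleftrightarrow> matrix_rep G n \<rho>"
proof
  assume h: "\<rho> \<in> hom G (GL_complex n)"
  have "\<rho> \<one>\<^bsub>G\<^esub> = \<one>\<^bsub>GL_complex n\<^esub>" by (rule hom_one[OF h assms group_GL_complex])
  then show "matrix_rep G n \<rho>"
    using h unfolding matrix_rep_def hom_def carrier_GL_complex
    by (auto simp: Pi_iff GL_complex_def units_of_def ring_mat_simps)
next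
  interpret group G by fact
  assume r: "matrix_rep G n \<rho>"
  have "\<rho> (inv\<^bsub>G\<^esub> g) * \<rho> g = 1\<^sub>m n \<and> \<rho> g * \<rho> (inv\<^bsub>G\<^esub> g) = 1\<^sub>m n" if "g \<in> carrier G" for g
    using that matrix_repD[OF r] by (metis inv_closed l_inv r_inv)
  then show "\<rho> \<in> hom G (GL_complex n)"
    using r unfolding matrix_rep_def hom_def carrier_GL_complex
    by (auto simp: Pi_iff GL_complex_def units_of_def ring_mat_simps)
qed

lemma subspace_vecI:
  assumes "W \<subseteq> carrier_vec n" "0\<^sub>v n \<in> W"
    and "\<And>v w. v \<in> W \<Longrightarrow> w \<in> W \<Longrightarrow> v + w \<in> W" "\<And>c w. w \<in> W \<Longrightarrow> c \<cdot>\<^sub>v w \<in> W"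
  shows "VectorSpace.subspace class_ring W (module_vec TYPE(complex) n)"
proof (rule VectorSpace.subspace.intro)
  show "vectorspace class_ring (module_vec TYPE(complex) n)" by (rule vec_vs)
  show "submodule class_ring W (module_vec TYPE(complex) n)"
    by (rule submodule.intro) (use assms vec_module in \<open>auto simp: module_vec_simps\<close>)
qed

context group
begin

lemma irreducible_rep_iff:
  "irreducible_rep G n \<rho> \<longleftrightarrow> n > 0 \<and> matrix_rep G n \<rho> \<and>
    (\<forall>W. VectorSpace.subspace class_ring W (module_vec TYPE(complex) n) \<and>
         (\<forall>g\<in>carrier G. \<forall>w\<in>W. \<rho> g *\<^sub>v w \<in> W) \<longrightarrow> W = {0\<^sub>v n} \<or> W = carrier_vec n)"
  unfolding irreducible_rep_def matrix_rep_iff_hom[OF is_group] ..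

lemma irreducible_rep_matrix_rep: "irreducible_rep G n \<rho> \<Longrightarrow> matrix_rep G n \<rho>"
  and irreducible_rep_pos: "irreducible_rep G n \<rho> \<Longrightarrow> 0 < n"
  unfolding irreducible_rep_iff by auto

lemma irreducible_rep_invariant:
  assumes "irreducible_rep G n \<rho>" "W \<subseteq> carrier_vec n" "0\<^sub>v n \<in> W"
    and "\<And>v w. v \<in> W \<Longrightarrow> w \<in> W \<Longrightarrow> v + w \<in> W" "\<And>c w. w \<in> W \<Longrightarrow> c \<cdot>\<^sub>v w \<in> W"
    and "\<And>g w. g \<in> carrier G \<Longrightarrow> w \<in> W \<Longrightarrow> \<rho> g *\<^sub>v w \<in> W"
    and "v \<in> W" "v \<noteq> 0\<^sub>v n"
  shows "W = carrier_vec n"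
proof -
  have "VectorSpace.subspace class_ring W (module_vec TYPE(complex) n)"
    by (rule subspace_vecI) (use assms in auto)
  then have "W = {0\<^sub>v n} \<or> W = carrier_vec n"
    using assms(1,6) unfolding irreducible_rep_iff by blast
  then show ?thesis using assms(7,8) by blast
qed

lemma matrix_rep_inv:
  assumes "matrix_rep G n \<rho>" "g \<in> carrier G"
  shows "\<rho> g * \<rho> (inv g) = 1\<^sub>m n" "\<rho> (inv g) * \<rho> g = 1\<^sub>m n"
  using assms matrix_repD[OF assms(1)] by (metis inv_closed r_inv l_inv)+

lemma matrix_rep_kernel_subgroup:
  assumes r: "matrix_rep G n \<rho>"
  shows "subgroup {g \<in> carrier G. \<rho> g = 1\<^sub>m n} G"
proof (rule subgroupI)
  show "inv g \<in> {g \<in> carrier G. \<rho> g = 1\<^sub>m n}" if "g \<in> {g \<in> carrier G. \<rho> g = 1\<^sub>m n}" for g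
    using that matrix_rep_inv(1)[OF r, of g] matrix_rep_carrier[OF r, of "inv g"] by auto
qed (use matrix_repD[OF r] in auto)

lemma schur:
  assumes irr: "irreducible_rep G n \<rho>" and A: "A \<in> carrier_mat n n"
    and comm: "\<And>g. g \<in> carrier G \<Longrightarrow> \<rho> g * A = A * \<rho> g"
  obtains c where "A = c \<cdot>\<^sub>m 1\<^sub>m n"
proof -
  note r = irreducible_rep_matrix_rep[OF irr]
  obtain k v where v: "v \<in> carrier_vec n" "v \<noteq> 0\<^sub>v n" "A *\<^sub>v v = k \<cdot>\<^sub>v v"
    using spectrum_non_empty[OF A irreducible_rep_pos[OF irr]] A
    unfolding spectrum_def eigenvalue_def eigenvector_def by auto
  let ?W = "{w \<in> carrier_vec n. A *\<^sub>v w = k \<cdot>\<^sub>v w}"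
  have W: "?W = carrier_vec n"
  proof (rule irreducible_rep_invariant[OF irr])
    show "v + w \<in> ?W" if "v \<in> ?W" "w \<in> ?W" for v w
      using that A by (auto simp: mult_add_distrib_mat_vec smult_add_distrib_vec)
    show "c \<cdot>\<^sub>v w \<in> ?W" if "w \<in> ?W" for c w
      using that A by (auto simp: mult_mat_vec smult_smult_assoc mult.commute)
    show "\<rho> g *\<^sub>v w \<in> ?W" if g: "g \<in> carrier G" and w: "w \<in> ?W" for g w
    proof -
      note R = matrix_rep_carrier[OF r g]
      have w': "w \<in> carrier_vec n" "A *\<^sub>v w = k \<cdot>\<^sub>v w" using w by auto
      have "A *\<^sub>v (\<rho> g *\<^sub>v w) = \<rho> g * A *\<^sub>v w"
        unfolding comm[OF g] by (rule assoc_mult_mat_vec[OF A R w'(1), symmetric])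
      also have "\<dots> = \<rho> g *\<^sub>v (k \<cdot>\<^sub>v w)"
        unfolding w'(2)[symmetric] by (rule assoc_mult_mat_vec[OF R A w'(1)])
      also have "\<dots> = k \<cdot>\<^sub>v (\<rho> g *\<^sub>v w)" by (rule mult_mat_vec[OF R w'(1)])
      finally show ?thesis using w R by auto
    qed
  qed (use v A in auto)
  have "A = k \<cdot>\<^sub>m 1\<^sub>m n"
  proof (rule eq_matI)
    fix i j assume "i < dim_row (k \<cdot>\<^sub>m 1\<^sub>m n)" "j < dim_col (k \<cdot>\<^sub>m 1\<^sub>m n)"
    then have ij: "i < n" "j < n" by auto
    have "unit_vec n j \<in> ?W" unfolding W by simp
    then have "(A *\<^sub>v unit_vec n j) $ i = (k \<cdot>\<^sub>v unit_vec n j) $ i" by simp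
    then show "A $$ (i, j) = (k \<cdot>\<^sub>m 1\<^sub>m n) $$ (i, j)"
      using ij A by simp
  qed (use A in auto)
  then show ?thesis by (rule that)
qed

lemma schur_trace:
  assumes irr: "irreducible_rep G n \<rho>" and A: "A \<in> carrier_mat n n"
    and comm: "\<And>g. g \<in> carrier G \<Longrightarrow> \<rho> g * A = A * \<rho> g"
  shows "A = (mat_trace A / of_nat n) \<cdot>\<^sub>m 1\<^sub>m n"
proof -
  obtain c where c: "A = c \<cdot>\<^sub>m 1\<^sub>m n" by (rule schur[OF irr A comm])
  then have "mat_trace A = c * of_nat n" by (simp add: mat_trace_smult[of _ n] mat_trace_one)
  then show ?thesis using c irreducible_rep_pos[OF irr] by simp
qed

lemma central_scalar:
  assumes irr: "irreducible_rep G n \<rho>" and z: "z \<in> center G"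
  obtains c where "\<rho> z = c \<cdot>\<^sub>m 1\<^sub>m n"
proof -
  note r = irreducible_rep_matrix_rep[OF irr]
  have zG: "z \<in> carrier G" using z unfolding center_def by blast
  have "\<rho> g * \<rho> z = \<rho> z * \<rho> g" if "g \<in> carrier G" for g
    using z that matrix_rep_mult[OF r] unfolding center_def by (metis (mono_tags, lifting) mem_Collect_eq)
  then show ?thesis using schur[OF irr matrix_rep_carrier[OF r zG]] that by blast
qed

text \<open>An irreducible representation has degree 1 iff it factors through the abelian group \<open>G / G'\<close>:
  if all \<open>\<rho> g\<close> commute, they are scalar by Schur's lemma, and then every subspace is invariant.\<close>

lemma degree_one_iff_trivial_on_commutator_subgroup:
  assumes irr: "irreducible_rep G n \<rho>"
  shows "n = 1 \<longleftrightarrow> (\<forall>d\<in>commutator_subgroup G. \<rho> d = 1\<^sub>m n)"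
proof
  note r = irreducible_rep_matrix_rep[OF irr]
  assume n: "n = 1"
  let ?K = "{g \<in> carrier G. \<rho> g = 1\<^sub>m n}"
  have comm: "A * B = B * A" if "A \<in> carrier_mat n n" "B \<in> carrier_mat n n" for A B :: "complex mat"
    using that n by (intro eq_matI) (auto simp: scalar_prod_def)
  have "commutator G x y \<in> ?K" if x: "x \<in> carrier G" and y: "y \<in> carrier G" for x y
  proof -
    let ?c = "\<rho> (commutator G x y)" and ?m = "\<rho> (y \<otimes> x)"
    have c: "?c \<in> carrier_mat n n" and m: "?m \<in> carrier_mat n n"
      using x y matrix_rep_carrier[OF r] by auto
    have "?c * ?m = ?m"
      using commutator_mult(1)[OF x y] x y matrix_rep_mult[OF r] comm
      by (metis commutator_closed m_closed matrix_rep_carrier[OF r])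
    then have "?c * (?m * \<rho> (inv (y \<otimes> x))) = ?m * \<rho> (inv (y \<otimes> x))"
      using c m x y matrix_rep_carrier[OF r, of "inv (y \<otimes> x)"]
      by (simp flip: assoc_mult_mat[of _ n n _ n _ n])
    then show ?thesis using x y c matrix_rep_inv(1)[OF r, of "y \<otimes> x"] by auto
  qed
  then have "commutator_subgroup G \<subseteq> ?K"
    unfolding commutator_subgroup_eq_generate
    by (intro generate_subgroup_incl matrix_rep_kernel_subgroup[OF r]) blast
  then show "\<forall>d\<in>commutator_subgroup G. \<rho> d = 1\<^sub>m n" by blast
next
  note r = irreducible_rep_matrix_rep[OF irr]
  assume triv: "\<forall>d\<in>commutator_subgroup G. \<rho> d = 1\<^sub>m n"
  have "\<rho> g * \<rho> h = \<rho> h * \<rho> g" if g: "g \<in> carrier G" and h: "h \<in> carrier G" for g h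
  proof -
    have "\<rho> (g \<otimes> h) = \<rho> (commutator G g h) * \<rho> (h \<otimes> g)"
      using commutator_mult(1)[OF g h] g h matrix_rep_mult[OF r] by (metis commutator_closed m_closed)
    also have "\<dots> = \<rho> (h \<otimes> g)"
      using triv g h matrix_rep_carrier[OF r, of "h \<otimes> g"] commutator_in_commutator_subgroup[OF g h]
      by simp
    finally show ?thesis using g h matrix_rep_mult[OF r] by simp
  qed
  then have scalar: "\<exists>c. \<rho> g = c \<cdot>\<^sub>m 1\<^sub>m n" if "g \<in> carrier G" for g
    using schur[OF irr matrix_rep_carrier[OF r that]] that by metis
  let ?W = "{w :: complex vec. w \<in> carrier_vec n \<and> (\<forall>i. 0 < i \<and> i < n \<longrightarrow> w $ i = 0)}"
  have n: "0 < n" by (rule irreducible_rep_pos[OF irr])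
  have "?W = carrier_vec n"
  proof (rule irreducible_rep_invariant[OF irr])
    show "unit_vec n 0 \<in> ?W" "unit_vec n 0 \<noteq> 0\<^sub>v n"
      using n by (auto simp: unit_vec_def dest: arg_cong[of _ _ "\<lambda>v. v $ 0"])
    fix g w assume g: "g \<in> carrier G" and w: "w \<in> ?W"
    obtain c where "\<rho> g = c \<cdot>\<^sub>m 1\<^sub>m n" using scalar[OF g] by blast
    moreover have "(c \<cdot>\<^sub>m 1\<^sub>m n) *\<^sub>v w = c \<cdot>\<^sub>v w"
      using w by (intro eq_vecI) (auto simp: scalar_prod_left_unit)
    ultimately show "\<rho> g *\<^sub>v w \<in> ?W" using w by auto
  qed auto
  moreover have "vec n (\<lambda>_. 1) \<in> carrier_vec n" by simp
  ultimately have "vec n (\<lambda>_. 1) \<in> ?W" by simp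
  then have "\<not> 1 < n" by auto
  then show "n = 1" using n by simp
qed

end

section \<open>Orthogonality and vanishing of characters\<close>

context group
begin

lemma bij_betw_mult_left:
  assumes h: "h \<in> carrier G"
  shows "bij_betw (\<lambda>g. h \<otimes> g) (carrier G) (carrier G)"
  by (rule bij_betwI[of _ _ _ "\<lambda>g. inv h \<otimes> g"]) (use h in auto)

lemma bij_betw_mult_right:
  assumes h: "h \<in> carrier G"
  shows "bij_betw (\<lambda>g. g \<otimes> h) (carrier G) (carrier G)"
  by (rule bij_betwI[of _ _ _ "\<lambda>g. g \<otimes> inv h"]) (use h in \<open>auto simp: m_assoc\<close>)

lemma bij_betw_conj_normal:
  assumes N: "N \<lhd> G" and h: "h \<in> carrier G"
  shows "bij_betw (\<lambda>d. h \<otimes> d \<otimes> inv h) N N"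
proof -
  interpret normal N G by (rule N)
  show ?thesis
  proof (rule bij_betwI[of _ _ _ "\<lambda>d. inv h \<otimes> d \<otimes> h"])
    show "(\<lambda>d. h \<otimes> d \<otimes> inv h) \<in> N \<rightarrow> N" using inv_op_closed2[OF h] by auto
    show "(\<lambda>d. inv h \<otimes> d \<otimes> h) \<in> N \<rightarrow> N" using inv_op_closed1[OF h] by auto
  qed (use h mem_carrier in \<open>auto simp: m_assoc\<close>)
qed

text \<open>Averaging an arbitrary matrix over the group produces a scalar, by Schur's lemma.\<close>

lemma schur_average:
  assumes irr: "irreducible_rep G n \<rho>" and A: "A \<in> carrier_mat n n"
  shows "mat_sum n (\<lambda>g. \<rho> g * A * \<rho> (inv g)) (carrier G) =
    (of_nat (Coset.order G) * mat_trace A / of_nat n) \<cdot>\<^sub>m 1\<^sub>m n" (is "?M = _")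
proof -
  note r = irreducible_rep_matrix_rep[OF irr]
  note R = matrix_rep_carrier[OF r]
  let ?f = "\<lambda>g. \<rho> g * A * \<rho> (inv g)"
  have f: "?f g \<in> carrier_mat n n" if g: "g \<in> carrier G" for g
    by (rule mult_carrier_mat[OF mult_carrier_mat[OF R[OF g] A] R[OF inv_closed[OF g]]])
  have "\<rho> h * ?M = ?M * \<rho> h" if h: "h \<in> carrier G" for h
  proof -
    have eq: "\<rho> h * ?f g = ?f (h \<otimes> g) * \<rho> h" if g: "g \<in> carrier G" for g
    proof -
      have car: "\<rho> h \<in> carrier_mat n n" "\<rho> g \<in> carrier_mat n n" "\<rho> (inv g) \<in> carrier_mat n n"
        using g h R by auto
      have cancel: "\<rho> (inv (h \<otimes> g)) * \<rho> h = \<rho> (inv g)"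
        using g h by (simp add: inv_mult_group m_assoc flip: matrix_rep_mult[OF r])
      have "?f (h \<otimes> g) * \<rho> h = \<rho> (h \<otimes> g) * A * (\<rho> (inv (h \<otimes> g)) * \<rho> h)"
        by (rule assoc_mult_mat[OF mult_carrier_mat[OF R[OF m_closed[OF h g]] A]
              R[OF inv_closed[OF m_closed[OF h g]]] R[OF h]])
      also have "\<dots> = \<rho> h * \<rho> g * A * \<rho> (inv g)"
        unfolding cancel using g h by (simp add: matrix_rep_mult[OF r])
      also have "\<dots> = \<rho> h * ?f g"
        using car A by (simp add: assoc_mult_mat[of _ n n _ n _ n])
      finally show ?thesis by simp
    qed
    have "\<rho> h * ?M = mat_sum n (\<lambda>g. ?f (h \<otimes> g) * \<rho> h) (carrier G)"
      using eq f R[OF h] by (simp add: mat_sum_mult_left cong: mat_sum_cong)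
    also have "\<dots> = mat_sum n (\<lambda>g. ?f g * \<rho> h) (carrier G)"
      by (rule mat_sum_reindex[OF bij_betw_mult_left[OF h], of n "\<lambda>g. ?f g * \<rho> h"])
    also have "\<dots> = ?M * \<rho> h" using f R[OF h] by (simp add: mat_sum_mult_right)
    finally show ?thesis .
  qed
  then have "?M = (mat_trace ?M / of_nat n) \<cdot>\<^sub>m 1\<^sub>m n"
    by (rule schur_trace[OF irr mat_sum_carrier])
  moreover have "mat_trace ?M = of_nat (Coset.order G) * mat_trace A"
  proof -
    have "mat_trace (?f g) = mat_trace A" if "g \<in> carrier G" for g
      by (rule mat_trace_conj[of _ n]) (use that A R matrix_rep_inv[OF r that] in auto)
    then show ?thesis using f by (simp add: mat_trace_mat_sum Coset.order_def)
  qed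
  ultimately show ?thesis by simp
qed

lemma class_sum_scalar:
  assumes irr: "irreducible_rep G n \<rho>" and x: "x \<in> carrier G"
  shows "mat_sum n (\<lambda>g. \<rho> (g \<otimes> x \<otimes> inv g)) (carrier G) =
    (of_nat (Coset.order G) * mat_trace (\<rho> x) / of_nat n) \<cdot>\<^sub>m 1\<^sub>m n"
proof -
  note r = irreducible_rep_matrix_rep[OF irr]
  have "mat_sum n (\<lambda>g. \<rho> (g \<otimes> x \<otimes> inv g)) (carrier G) =
      mat_sum n (\<lambda>g. \<rho> g * \<rho> x * \<rho> (inv g)) (carrier G)"
    by (rule mat_sum_cong) (use x matrix_rep_mult[OF r] in auto)
  then show ?thesis using schur_average[OF irr matrix_rep_carrier[OF r x]] by simp
qed

text \<open>Row orthogonality. The entry \<open>(i, j)\<close> of the average of the elementary matrix \<open>E i j\<close> is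
  \<open>\<Sum>\<^sub>g \<rho>(g)\<^sub>i\<^sub>i \<rho>(g\<inverse>)\<^sub>j\<^sub>j\<close>, which is \<open>|G| / n\<close> if \<open>i = j\<close> and 0 otherwise.\<close>

lemma character_norm:
  assumes irr: "irreducible_rep G n \<rho>"
  shows "(\<Sum>g\<in>carrier G. mat_trace (\<rho> g) * mat_trace (\<rho> (inv g))) = of_nat (Coset.order G)"
proof -
  note r = irreducible_rep_matrix_rep[OF irr]
  note R = matrix_rep_carrier[OF r]
  have n: "0 < n" by (rule irreducible_rep_pos[OF irr])
  have entry: "(\<Sum>g\<in>carrier G. \<rho> g $$ (i, i) * \<rho> (inv g) $$ (j, j)) =
      (if i = j then of_nat (Coset.order G) / of_nat n else 0)" if ij: "i < n" "j < n" for i j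
  proof -
    let ?E = "mat n n (\<lambda>(k, l). if k = i \<and> l = j then 1 else 0) :: complex mat"
    have E: "?E \<in> carrier_mat n n" by simp
    have "mat_trace ?E = (\<Sum>k<n. if k = i then if i = j then 1 else 0 else 0)"
      unfolding mat_trace_carrier[OF E] by (intro sum.cong) auto
    then have trE: "mat_trace ?E = (if i = j then 1 else 0)" using ij by simp
    have "(\<rho> g * ?E * \<rho> (inv g)) $$ (i, j) = \<rho> g $$ (i, i) * \<rho> (inv g) $$ (j, j)"
      if g: "g \<in> carrier G" for g
    proof -
      have 1: "(\<rho> g * ?E) $$ (i, k) = (if k = j then \<rho> g $$ (i, i) else 0)" if k: "k < n" for k
      proof -
        have "(\<rho> g * ?E) $$ (i, k) = (\<Sum>l<n. \<rho> g $$ (i, l) * ?E $$ (l, k))"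
          by (rule mat_mult_index[OF R[OF g] E ij(1) k])
        also have "\<dots> = (\<Sum>l<n. if l = i then if k = j then \<rho> g $$ (i, i) else 0 else 0)"
          using k by (intro sum.cong) auto
        finally show ?thesis using ij by simp
      qed
      have "(\<rho> g * ?E * \<rho> (inv g)) $$ (i, j) = (\<Sum>k<n. (\<rho> g * ?E) $$ (i, k) * \<rho> (inv g) $$ (k, j))"
        by (rule mat_mult_index[OF mult_carrier_mat[OF R[OF g] E] R[OF inv_closed[OF g]] ij])
      also have "\<dots> = (\<Sum>k<n. if k = j then \<rho> g $$ (i, i) * \<rho> (inv g) $$ (j, j) else 0)"
        by (intro sum.cong) (auto simp: 1 simp del: index_mult_mat(1))
      finally show ?thesis using ij by simp
    qed
    then have "(\<Sum>g\<in>carrier G. \<rho> g $$ (i, i) * \<rho> (inv g) $$ (j, j)) =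
        mat_sum n (\<lambda>g. \<rho> g * ?E * \<rho> (inv g)) (carrier G) $$ (i, j)"
      using ij by (simp add: mat_sum_index del: index_mult_mat(1))
    also have "\<dots> = (if i = j then of_nat (Coset.order G) / of_nat n else 0)"
      unfolding schur_average[OF irr E] trE using ij by simp
    finally show ?thesis .
  qed
  have "(\<Sum>g\<in>carrier G. mat_trace (\<rho> g) * mat_trace (\<rho> (inv g))) =
      (\<Sum>g\<in>carrier G. \<Sum>i<n. \<Sum>j<n. \<rho> g $$ (i, i) * \<rho> (inv g) $$ (j, j))"
    using R by (simp add: mat_trace_carrier[of _ n] sum_product)
  also have "\<dots> = (\<Sum>i<n. \<Sum>j<n. \<Sum>g\<in>carrier G. \<rho> g $$ (i, i) * \<rho> (inv g) $$ (j, j))"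
    by (subst sum.swap) (simp add: sum.swap[of _ "{..<n}" "carrier G"])
  also have "\<dots> = of_nat (Coset.order G)" using n by (simp add: entry)
  finally show ?thesis .
qed

text \<open>A central \<open>z\<close> contributes \<open>n\<^sup>2\<close> to the sum in row orthogonality, because \<open>\<rho> z\<close> is scalar.\<close>

lemma character_norm_off_center:
  assumes fin: "finite (carrier G)" and irr: "irreducible_rep G n \<rho>"
  shows "(\<Sum>g\<in>carrier G - center G. mat_trace (\<rho> g) * mat_trace (\<rho> (inv g))) =
    of_nat (Coset.order G) - of_nat (card (center G)) * (of_nat n)\<^sup>2"
proof -
  note r = irreducible_rep_matrix_rep[OF irr]
  have sub: "center G \<subseteq> carrier G" unfolding center_def by blast
  have "mat_trace (\<rho> z) * mat_trace (\<rho> (inv z)) = (of_nat n)\<^sup>2" if z: "z \<in> center G" for z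
  proof -
    have zG: "z \<in> carrier G" and iz: "inv z \<in> center G"
      using z sub subgroup.m_inv_closed[OF subgroup_center z] by auto
    obtain c where c: "\<rho> z = c \<cdot>\<^sub>m 1\<^sub>m n" by (rule central_scalar[OF irr z])
    obtain d where d: "\<rho> (inv z) = d \<cdot>\<^sub>m 1\<^sub>m n" by (rule central_scalar[OF irr iz])
    have "(c \<cdot>\<^sub>m 1\<^sub>m n) * (d \<cdot>\<^sub>m 1\<^sub>m n) = 1\<^sub>m n"
      using matrix_rep_inv(1)[OF r zG] unfolding c d .
    then have "d \<cdot>\<^sub>m (c \<cdot>\<^sub>m 1\<^sub>m n) = (1\<^sub>m n :: complex mat)"
      by (simp add: mult_smult_assoc_mat[of _ n n _ n] mult_smult_distrib[of _ n n _ n])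
    then have "(d \<cdot>\<^sub>m (c \<cdot>\<^sub>m 1\<^sub>m n)) $$ (0, 0) = (1\<^sub>m n :: complex mat) $$ (0, 0)" by simp
    then have cd: "c * d = 1" using irreducible_rep_pos[OF irr] by (simp add: mult.commute)
    have "mat_trace (\<rho> z) * mat_trace (\<rho> (inv z)) = c * d * (of_nat n)\<^sup>2"
      unfolding c d by (simp add: mat_trace_smult[of _ n] mat_trace_one power2_eq_square mult_ac)
    then show ?thesis unfolding cd by simp
  qed
  then have "(\<Sum>g\<in>center G. mat_trace (\<rho> g) * mat_trace (\<rho> (inv g))) =
      of_nat (card (center G)) * (of_nat n)\<^sup>2" by simp
  then show ?thesis
    using character_norm[OF irr] sum.subset_diff[OF sub fin, of "\<lambda>g. mat_trace (\<rho> g) * mat_trace (\<rho> (inv g))"]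
    by (simp add: algebra_simps)
qed

text \<open>The Hermitian form with matrix \<open>H = \<Sum>\<^sub>g \<rho>(g)\<^sup>* \<rho>(g)\<close> is invariant and positive definite, so
  \<open>\<rho>(g\<inverse>)\<close> is conjugate to the adjoint of \<open>\<rho>(g)\<close>.\<close>

lemma mat_trace_inv:
  assumes r: "matrix_rep G n \<rho>" and fin: "finite (carrier G)" and h: "h \<in> carrier G"
  shows "mat_trace (\<rho> (inv h)) = cnj (mat_trace (\<rho> h))"
proof -
  note R = matrix_rep_carrier[OF r]
  define adj :: "complex mat \<Rightarrow> complex mat" where "adj A = (map_mat cnj A)\<^sup>T" for A
  have adj_carrier: "adj A \<in> carrier_mat n n" if "A \<in> carrier_mat n n" for A
    using that unfolding adj_def by simp
  have adj_index: "adj A $$ (i, j) = cnj (A $$ (j, i))"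
    if "A \<in> carrier_mat n n" "i < n" "j < n" for A i j
    using that unfolding adj_def by simp
  have adj_mult: "adj (A * B) = adj B * adj A" if "A \<in> carrier_mat n n" "B \<in> carrier_mat n n" for A B
  proof (rule eq_matI)
    fix i j assume "i < dim_row (adj B * adj A)" "j < dim_col (adj B * adj A)"
    then have ij: "i < n" "j < n" using that unfolding adj_def by auto
    have "adj (A * B) $$ (i, j) = (\<Sum>k<n. cnj (A $$ (j, k)) * cnj (B $$ (k, i)))"
      using that ij by (simp add: adj_index mat_mult_index[of _ n n _ n] del: index_mult_mat(1))
    also have "\<dots> = (adj B * adj A) $$ (i, j)"
      using that ij by (simp add: adj_index adj_carrier mat_mult_index[of _ n n _ n] mult.commute
        del: index_mult_mat(1))
    finally show "adj (A * B) $$ (i, j) = (adj B * adj A) $$ (i, j)" .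
  qed (use that in \<open>auto simp: adj_def\<close>)
  let ?f = "\<lambda>g. adj (\<rho> g) * \<rho> g"
  let ?H = "mat_sum n ?f (carrier G)"
  have f: "?f g \<in> carrier_mat n n" if "g \<in> carrier G" for g
    using adj_carrier[OF R[OF that]] R[OF that] by simp
  have invariant: "adj (\<rho> h) * ?H = ?H * \<rho> (inv h)"
  proof -
    have eq: "adj (\<rho> h) * ?f g = ?f (g \<otimes> h) * \<rho> (inv h)" if g: "g \<in> carrier G" for g
    proof -
      have 1: "\<rho> (g \<otimes> h) * \<rho> (inv h) = \<rho> g"
        using g h by (simp add: m_assoc flip: matrix_rep_mult[OF r])
      have "?f (g \<otimes> h) * \<rho> (inv h) = adj (\<rho> (g \<otimes> h)) * (\<rho> (g \<otimes> h) * \<rho> (inv h))"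
        by (rule assoc_mult_mat[of _ n n _ n _ n]) (use g h R adj_carrier in auto)
      also have "\<dots> = adj (\<rho> h) * adj (\<rho> g) * \<rho> g"
        unfolding 1 using adj_mult[OF R[OF g] R[OF h]] matrix_rep_mult[OF r g h] by simp
      also have "\<dots> = adj (\<rho> h) * ?f g"
        by (rule assoc_mult_mat[of _ n n _ n _ n]) (use g h R adj_carrier in auto)
      finally show ?thesis by simp
    qed
    have "adj (\<rho> h) * ?H = mat_sum n (\<lambda>g. ?f (g \<otimes> h) * \<rho> (inv h)) (carrier G)"
      using eq f adj_carrier[OF R[OF h]] by (simp add: mat_sum_mult_left cong: mat_sum_cong)
    also have "\<dots> = mat_sum n (\<lambda>g. ?f g * \<rho> (inv h)) (carrier G)"
      by (rule mat_sum_reindex[OF bij_betw_mult_right[OF h], of n "\<lambda>g. ?f g * \<rho> (inv h)"])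
    also have "\<dots> = ?H * \<rho> (inv h)" using f h R by (simp add: mat_sum_mult_right)
    finally show ?thesis .
  qed
  have "det ?H \<noteq> 0"
  proof
    assume "det ?H = 0"
    then obtain v where v: "v \<in> carrier_vec n" "v \<noteq> 0\<^sub>v n" "?H *\<^sub>v v = 0\<^sub>v n"
      using det_0_iff_vec_prod_zero[OF mat_sum_carrier] by blast
    \<comment> \<open>\<open>u g\<close> is \<open>\<rho> g *\<^sub>v v\<close>, so \<open>v\<^sup>* H v\<close> is the sum of the squared norms of all \<open>u g\<close>.\<close>
    define u where "u g k = (\<Sum>j<n. \<rho> g $$ (k, j) * v $ j)" for g k
    have rotate: "(\<Sum>i<n. \<Sum>g\<in>carrier G. \<Sum>k<n. F i g k) = (\<Sum>g\<in>carrier G. \<Sum>k<n. \<Sum>i<n. F i g k)"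
      for F :: "nat \<Rightarrow> 'a \<Rightarrow> nat \<Rightarrow> complex"
      by (subst sum.swap, rule sum.cong[OF refl], rule sum.swap)
    have entry: "?H $$ (i, j) = (\<Sum>g\<in>carrier G. \<Sum>k<n. cnj (\<rho> g $$ (k, i)) * \<rho> g $$ (k, j))"
      if "i < n" "j < n" for i j
      using that R by (simp add: mat_sum_index mat_mult_index[of _ n n _ n] adj_carrier adj_index
        del: index_mult_mat(1))
    have Hv: "(?H *\<^sub>v v) $ i = (\<Sum>g\<in>carrier G. \<Sum>k<n. cnj (\<rho> g $$ (k, i)) * u g k)"
      if i: "i < n" for i
    proof -
      have "(?H *\<^sub>v v) $ i = (\<Sum>j<n. ?H $$ (i, j) * v $ j)"
        using i v(1) carrier_matD[OF mat_sum_carrier[of n ?f "carrier G"]]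
        by (simp add: scalar_prod_def lessThan_atLeast0)
      also have "\<dots> = (\<Sum>j<n. \<Sum>g\<in>carrier G. \<Sum>k<n. cnj (\<rho> g $$ (k, i)) * (\<rho> g $$ (k, j) * v $ j))"
        using i by (simp add: entry sum_distrib_right mult.assoc)
      finally show ?thesis unfolding rotate u_def by (simp add: sum_distrib_left)
    qed
    have "0 = (\<Sum>i<n. cnj (v $ i) * (?H *\<^sub>v v) $ i)" using v by simp
    also have "\<dots> = (\<Sum>i<n. \<Sum>g\<in>carrier G. \<Sum>k<n. cnj (\<rho> g $$ (k, i) * v $ i) * u g k)"
      by (simp add: Hv sum_distrib_left mult_ac)
    also have "\<dots> = (\<Sum>g\<in>carrier G. \<Sum>k<n. cnj (u g k) * u g k)"
      unfolding rotate by (simp add: u_def flip: sum_distrib_right)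
    also have "\<dots> = (\<Sum>g\<in>carrier G. \<Sum>k<n. of_real ((cmod (u g k))\<^sup>2))"
      by (simp only: complex_norm_square mult.commute[of "cnj _"])
    finally have "complex_of_real (\<Sum>g\<in>carrier G. \<Sum>k<n. (cmod (u g k))\<^sup>2) = 0" by simp
    then have "(\<Sum>g\<in>carrier G. \<Sum>k<n. (cmod (u g k))\<^sup>2) = 0" using of_real_eq_0_iff by blast
    then have "(\<Sum>k<n. (cmod (u \<one> k))\<^sup>2) = 0"
      using fin by (subst (asm) sum_nonneg_eq_0_iff) (auto intro: sum_nonneg)
    then have zero: "u \<one> k = 0" if "k < n" for k
      using that by (subst (asm) sum_nonneg_eq_0_iff) auto
    have "v $ k = 0" if k: "k < n" for k
    proof -
      have "u \<one> k = (\<Sum>i<n. if i = k then v $ k else 0)"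
        unfolding u_def matrix_rep_one[OF r] using k by (intro sum.cong) auto
      then show ?thesis using zero[OF k] k by simp
    qed
    then show False using v(1,2) by (auto intro!: eq_vecI)
  qed
  then obtain Q where Q: "Q \<in> carrier_mat n n" "Q * ?H = 1\<^sub>m n" "?H * Q = 1\<^sub>m n"
    using det_non_zero_imp_unit[OF mat_sum_carrier, of n ?f "carrier G"]
    unfolding Units_def ring_mat_simps by auto
  have "\<rho> (inv h) = Q * adj (\<rho> h) * ?H"
  proof -
    note Rh = R[OF h] and Ri = R[OF inv_closed[OF h]]
    have "Q * adj (\<rho> h) * ?H = Q * (?H * \<rho> (inv h))"
      unfolding invariant[symmetric] by (rule assoc_mult_mat[OF Q(1) adj_carrier[OF Rh] mat_sum_carrier])
    also have "\<dots> = Q * ?H * \<rho> (inv h)"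
      by (rule assoc_mult_mat[OF Q(1) mat_sum_carrier Ri, symmetric])
    finally show ?thesis using Q(2) Ri by simp
  qed
  then have "mat_trace (\<rho> (inv h)) = mat_trace (adj (\<rho> h))"
    using mat_trace_conj[OF adj_carrier[OF R[OF h]] mat_sum_carrier Q(1,3)] by simp
  also have "\<dots> = cnj (mat_trace (\<rho> h))"
    using R[OF h] by (simp add: mat_trace_carrier[of _ n] adj_carrier adj_index)
  finally show ?thesis .
qed

text \<open>If \<open>n\<^sup>2 = |G : Z(G)|\<close>, the centre exhausts the norm, so \<open>\<Sum> |\<chi>(g)|\<^sup>2\<close> over the other elements is 0.\<close>

lemma character_vanishes_off_center:
  assumes fin: "finite (carrier G)" and irr: "irreducible_rep G n \<rho>"
    and n: "card (center G) * n\<^sup>2 = Coset.order G" and x: "x \<in> carrier G - center G"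
  shows "mat_trace (\<rho> x) = 0"
proof -
  note r = irreducible_rep_matrix_rep[OF irr]
  have "(\<Sum>g\<in>carrier G - center G. complex_of_real ((cmod (mat_trace (\<rho> g)))\<^sup>2)) =
      (\<Sum>g\<in>carrier G - center G. mat_trace (\<rho> g) * mat_trace (\<rho> (inv g)))"
    by (intro sum.cong) (simp_all add: mat_trace_inv[OF r fin] complex_norm_square del: of_real_power)
  also have "\<dots> = 0"
    unfolding character_norm_off_center[OF fin irr] n[symmetric] by simp
  finally have "complex_of_real (\<Sum>g\<in>carrier G - center G. (cmod (mat_trace (\<rho> g)))\<^sup>2) = 0" by simp
  then have "(\<Sum>g\<in>carrier G - center G. (cmod (mat_trace (\<rho> g)))\<^sup>2) = 0"
    using of_real_eq_0_iff by blast
  then show ?thesis using x fin by (subst (asm) sum_nonneg_eq_0_iff) auto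
qed

end

section \<open>Completeness of the irreducible representations\<close>

context group
begin

text \<open>A representation by block upper triangular matrices restricts to its diagonal blocks.\<close>

lemma matrix_rep_diagonal_blocks:
  assumes r: "matrix_rep G n \<rho>" and mn: "m \<le> n"
    and block: "\<And>g i j. g \<in> carrier G \<Longrightarrow> m \<le> i \<Longrightarrow> i < n \<Longrightarrow> j < m \<Longrightarrow> \<rho> g $$ (i, j) = 0"
  shows "matrix_rep G m (\<lambda>g. mat m m (\<lambda>(i, j). \<rho> g $$ (i, j)))"
    and "matrix_rep G (n - m) (\<lambda>g. mat (n - m) (n - m) (\<lambda>(i, j). \<rho> g $$ (i + m, j + m)))"
proof -
  note R = matrix_rep_carrier[OF r]
  have sum_blocks: "(\<Sum>k<n. f k) = (\<Sum>k<m. f k) + (\<Sum>k<n - m. f (k + m))" for f :: "nat \<Rightarrow> complex"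
  proof -
    have "(\<Sum>k<n. f k) = (\<Sum>k<m. f k) + (\<Sum>k=m..<n. f k)"
      using sum.atLeastLessThan_concat[of 0 m n f] mn by (simp add: lessThan_atLeast0)
    also have "(\<Sum>k=m..<n. f k) = (\<Sum>k<n - m. f (k + m))"
      using sum.shift_bounds_nat_ivl[of f 0 m "n - m"] mn by (simp add: lessThan_atLeast0)
    finally show ?thesis .
  qed
  have prod: "\<rho> (g \<otimes> h) $$ (i, j) = (\<Sum>k<n. \<rho> g $$ (i, k) * \<rho> h $$ (k, j))"
    if "g \<in> carrier G" "h \<in> carrier G" "i < n" "j < n" for g h i j
    using mat_mult_index[OF R R] that matrix_rep_mult[OF r] by simp
  show "matrix_rep G m (\<lambda>g. mat m m (\<lambda>(i, j). \<rho> g $$ (i, j)))"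
    unfolding matrix_rep_def
  proof (intro conjI ballI)
    fix g h assume g: "g \<in> carrier G" and h: "h \<in> carrier G"
    show "mat m m (\<lambda>(i, j). \<rho> (g \<otimes> h) $$ (i, j)) =
        mat m m (\<lambda>(i, j). \<rho> g $$ (i, j)) * mat m m (\<lambda>(i, j). \<rho> h $$ (i, j))"
      using mn block[OF h]
      by (intro eq_matI) (simp_all add: prod[OF g h] mat_mult_index[of _ m m _ m] sum_blocks
        del: index_mult_mat(1))
  qed (use mn in \<open>auto simp: matrix_rep_one[OF r] intro!: eq_matI\<close>)
  show "matrix_rep G (n - m) (\<lambda>g. mat (n - m) (n - m) (\<lambda>(i, j). \<rho> g $$ (i + m, j + m)))"
    unfolding matrix_rep_def
  proof (intro conjI ballI)
    fix g h assume g: "g \<in> carrier G" and h: "h \<in> carrier G"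
    show "mat (n - m) (n - m) (\<lambda>(i, j). \<rho> (g \<otimes> h) $$ (i + m, j + m)) =
        mat (n - m) (n - m) (\<lambda>(i, j). \<rho> g $$ (i + m, j + m)) *
        mat (n - m) (n - m) (\<lambda>(i, j). \<rho> h $$ (i + m, j + m))"
      using mn block[OF g]
      by (intro eq_matI) (simp_all add: prod[OF g h] mat_mult_index[of _ "n - m" "n - m" _ "n - m"] sum_blocks
        del: index_mult_mat(1))
  qed (use mn in \<open>auto simp: matrix_rep_one[OF r] intro!: eq_matI\<close>)
qed

lemma mat_trace_diagonal_blocks:
  assumes "A \<in> carrier_mat n n" "m \<le> n"
  shows "mat_trace A = mat_trace (mat m m (\<lambda>(i, j). A $$ (i, j))) +
    mat_trace (mat (n - m) (n - m) (\<lambda>(i, j). A $$ (i + m, j + m)))"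
proof -
  have "(\<Sum>k<n. A $$ (k, k)) = (\<Sum>k<m. A $$ (k, k)) + (\<Sum>k=m..<n. A $$ (k, k))"
    using sum.atLeastLessThan_concat[of 0 m n "\<lambda>k. A $$ (k, k)"] assms(2) by (simp add: lessThan_atLeast0)
  also have "(\<Sum>k=m..<n. A $$ (k, k)) = (\<Sum>k<n - m. A $$ (k + m, k + m))"
    using sum.shift_bounds_nat_ivl[of "\<lambda>k. A $$ (k, k)" 0 m "n - m"] assms(2)
    by (simp add: lessThan_atLeast0)
  finally show ?thesis using assms(1) by (simp add: mat_trace_def)
qed

text \<open>The trace of every representation is a sum of irreducible characters, so a linear relation
  between the values of all irreducible characters passes to all traces. Splitting along an
  invariant subspace only needs a block triangular form, not complete reducibility.\<close>

lemma trace_relation_from_irreducible: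
  assumes irr: "\<And>m \<sigma>. irreducible_rep G m \<sigma> \<Longrightarrow> (\<Sum>g\<in>carrier G. a g * mat_trace (\<sigma> g)) = 0"
    and "matrix_rep G n \<rho>"
  shows "(\<Sum>g\<in>carrier G. a g * mat_trace (\<rho> g)) = 0"
  using assms(2)
proof (induction n arbitrary: \<rho> rule: less_induct)
  case (less n)
  note r = less.prems
  note R = matrix_rep_carrier[OF r]
  consider "n = 0" | "irreducible_rep G n \<rho>" | "n > 0" "\<not> irreducible_rep G n \<rho>" by blast
  then show ?case
  proof cases
    case 1
    then show ?thesis using R by (simp add: mat_trace_carrier[of _ 0])
  next
    case 2
    then show ?thesis by (rule irr)
  next
    case 3
    then obtain W where W: "VectorSpace.subspace class_ring W (module_vec TYPE(complex) n)"
        "\<And>g w. g \<in> carrier G \<Longrightarrow> w \<in> W \<Longrightarrow> \<rho> g *\<^sub>v w \<in> W" "W \<noteq> {0\<^sub>v n}" "W \<noteq> carrier_vec n"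
      unfolding irreducible_rep_iff using r by blast
    interpret vec_space "TYPE(complex)" n .
    obtain m P Q where m: "0 < m" "m < n" and P: "P \<in> carrier_mat n n" and Q: "Q \<in> carrier_mat n n"
      and PQ: "P * Q = 1\<^sub>m n" and PW: "\<And>j. j < m \<Longrightarrow> col P j \<in> W"
      and QW: "\<And>w i. w \<in> W \<Longrightarrow> m \<le> i \<Longrightarrow> i < n \<Longrightarrow> (Q *\<^sub>v w) $ i = 0"
      by (rule adapted_basis[OF W(1,3,4)]) blast
    have QP: "Q * P = 1\<^sub>m n" by (rule mat_mult_left_right_inverse[OF P Q PQ])
    let ?\<tau> = "\<lambda>g. Q * \<rho> g * P"
    have T: "?\<tau> g \<in> carrier_mat n n" if "g \<in> carrier G" for g
      by (rule mult_carrier_mat[OF mult_carrier_mat[OF Q R[OF that]] P])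
    have rep: "matrix_rep G n ?\<tau>"
      unfolding matrix_rep_def
    proof (intro conjI ballI)
      show "?\<tau> \<one> = 1\<^sub>m n" using QP Q by (simp add: matrix_rep_one[OF r])
      fix g h assume g: "g \<in> carrier G" and h: "h \<in> carrier G"
      note Rg = R[OF g] and Rh = R[OF h]
      have "?\<tau> g * ?\<tau> h = Q * \<rho> g * (P * (Q * \<rho> h * P))"
        by (rule assoc_mult_mat[OF mult_carrier_mat[OF Q Rg] P T[OF h]])
      also have "P * (Q * \<rho> h * P) = P * (Q * (\<rho> h * P))"
        by (simp only: assoc_mult_mat[OF Q Rh P])
      also have "\<dots> = P * Q * (\<rho> h * P)"
        by (rule assoc_mult_mat[OF P Q mult_carrier_mat[OF Rh P], symmetric])
      also have "\<dots> = \<rho> h * P" unfolding PQ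
        by (rule left_mult_one_mat[OF mult_carrier_mat[OF Rh P]])
      also have "Q * \<rho> g * (\<rho> h * P) = Q * \<rho> g * \<rho> h * P"
        by (rule assoc_mult_mat[OF mult_carrier_mat[OF Q Rg] Rh P, symmetric])
      also have "\<dots> = Q * (\<rho> g * \<rho> h) * P" by (simp only: assoc_mult_mat[OF Q Rg Rh])
      finally show "?\<tau> (g \<otimes> h) = ?\<tau> g * ?\<tau> h" using matrix_rep_mult[OF r g h] by simp
    qed (rule T)
    have block: "?\<tau> g $$ (i, j) = 0" if g: "g \<in> carrier G" and i: "m \<le> i" "i < n" and j: "j < m" for g i j
    proof -
      have jn: "j < n" using j m by simp
      have "col (?\<tau> g) j = Q * \<rho> g *\<^sub>v col P j"
        by (rule col_mult2[OF mult_carrier_mat[OF Q R[OF g]] P jn])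
      also have "\<dots> = Q *\<^sub>v (\<rho> g *\<^sub>v col P j)"
        by (rule assoc_mult_mat_vec[OF Q R[OF g] col_carrier_vec[OF jn P]])
      finally have "col (?\<tau> g) j $ i = 0" using QW[OF W(2)[OF g PW[OF j]] i] by simp
      then show ?thesis using T[OF g] P Q i jn by (simp add: col_def)
    qed
    have mn: "m \<le> n" using m by simp
    let ?\<tau>1 = "\<lambda>g. mat m m (\<lambda>(i, j). ?\<tau> g $$ (i, j))"
    let ?\<tau>2 = "\<lambda>g. mat (n - m) (n - m) (\<lambda>(i, j). ?\<tau> g $$ (i + m, j + m))"
    have reps: "matrix_rep G m ?\<tau>1" "matrix_rep G (n - m) ?\<tau>2"
      using matrix_rep_diagonal_blocks[OF rep mn block] by auto
    have "mat_trace (\<rho> g) = mat_trace (?\<tau>1 g) + mat_trace (?\<tau>2 g)" if g: "g \<in> carrier G" for g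
      using mat_trace_conj[OF R[OF g] P Q PQ] mat_trace_diagonal_blocks[OF T[OF g] mn] by simp
    then have "(\<Sum>g\<in>carrier G. a g * mat_trace (\<rho> g)) =
        (\<Sum>g\<in>carrier G. a g * mat_trace (?\<tau>1 g)) + (\<Sum>g\<in>carrier G. a g * mat_trace (?\<tau>2 g))"
      by (simp add: distrib_left sum.distrib del: index_mult_mat(1) cong: sum.cong)
    also have "\<dots> = 0"
      using less.IH[OF m(2) reps(1)] less.IH[OF _ reps(2)] m by simp
    finally show ?thesis .
  qed
qed

text \<open>The regular representation, on the basis of group elements enumerated by \<open>e\<close>.\<close>

lemma regular_matrix_rep:
  assumes fin: "finite (carrier G)"
  obtains \<rho> where "matrix_rep G (Coset.order G) \<rho>"
    "\<And>g. g \<in> carrier G \<Longrightarrow> mat_trace (\<rho> g) = (if g = \<one> then of_nat (Coset.order G) else 0)"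
proof -
  let ?N = "Coset.order G"
  obtain e where e: "bij_betw e {..<?N} (carrier G)"
    using ex_bij_betw_nat_finite[OF fin] unfolding Coset.order_def lessThan_atLeast0 by blast
  have eG: "e i \<in> carrier G" if "i < ?N" for i using e that unfolding bij_betw_def by auto
  have e_inj: "e i = e j \<longleftrightarrow> i = j" if "i < ?N" "j < ?N" for i j
    using e that unfolding bij_betw_def inj_on_def by auto
  let ?\<rho> = "\<lambda>g. mat ?N ?N (\<lambda>(i, j). if e i = g \<otimes> e j then 1 else 0) :: complex mat"
  have mult: "?\<rho> (g \<otimes> h) = ?\<rho> g * ?\<rho> h" if g: "g \<in> carrier G" and h: "h \<in> carrier G" for g h
  proof (rule eq_matI)
    fix i j assume "i < dim_row (?\<rho> g * ?\<rho> h)" "j < dim_col (?\<rho> g * ?\<rho> h)"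
    then have ij: "i < ?N" "j < ?N" by auto
    have "h \<otimes> e j \<in> e ` {..<?N}" using h eG ij bij_betw_imp_surj_on[OF e] by simp
    then obtain l where l: "l < ?N" "e l = h \<otimes> e j" by (metis imageE lessThan_iff)
    have "(?\<rho> g * ?\<rho> h) $$ (i, j) = (\<Sum>k<?N. ?\<rho> g $$ (i, k) * ?\<rho> h $$ (k, j))"
      by (rule mat_mult_index[of _ ?N ?N _ ?N]) (use ij in auto)
    also have "\<dots> = (\<Sum>k<?N. if k = l then ?\<rho> g $$ (i, l) else 0)"
      using ij l(1) e_inj by (intro sum.cong) (auto simp: l(2)[symmetric])
    also have "\<dots> = ?\<rho> (g \<otimes> h) $$ (i, j)"
      using ij l g h eG by (simp add: m_assoc)
    finally show "?\<rho> (g \<otimes> h) $$ (i, j) = (?\<rho> g * ?\<rho> h) $$ (i, j)" by simp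
  qed auto
  show ?thesis
  proof (rule that)
    show "matrix_rep G ?N ?\<rho>"
      unfolding matrix_rep_def using mult e_inj eG by (auto intro!: eq_matI)
    fix g assume g: "g \<in> carrier G"
    have "e i = g \<otimes> e i \<longleftrightarrow> g = \<one>" if "i < ?N" for i using g eG[OF that] by simp
    then show "mat_trace (?\<rho> g) = (if g = \<one> then of_nat ?N else 0)"
      unfolding mat_trace_def by simp
  qed
qed

text \<open>An element \<open>\<Sum>\<^sub>g a(g) g\<close> of the group algebra that vanishes in every irreducible
  representation is zero: the trace of its translates in the regular representation reads off the
  coefficients.\<close>

lemma irreducible_reps_separate:
  assumes fin: "finite (carrier G)"
    and irr: "\<And>m \<sigma> i j. irreducible_rep G m \<sigma> \<Longrightarrow> i < m \<Longrightarrow> j < m \<Longrightarrow>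
      (\<Sum>g\<in>carrier G. a g * \<sigma> g $$ (i, j)) = 0"
    and h: "h \<in> carrier G"
  shows "a h = 0"
proof -
  obtain \<rho> where \<rho>: "matrix_rep G (Coset.order G) \<rho>"
    "\<And>g. g \<in> carrier G \<Longrightarrow> mat_trace (\<rho> g) = (if g = \<one> then of_nat (Coset.order G) else 0)"
    using regular_matrix_rep[OF fin] by blast
  have "(\<Sum>g\<in>carrier G. a (g \<otimes> h) * mat_trace (\<sigma> g)) = 0" if s: "irreducible_rep G m \<sigma>" for m \<sigma>
  proof -
    note r = irreducible_rep_matrix_rep[OF s]
    note R = matrix_rep_carrier[OF r]
    have tr: "mat_trace (\<sigma> (g \<otimes> inv h)) = (\<Sum>i<m. \<Sum>j<m. \<sigma> g $$ (i, j) * \<sigma> (inv h) $$ (j, i))"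
      if g: "g \<in> carrier G" for g
    proof -
      have "mat_trace (\<sigma> (g \<otimes> inv h)) = (\<Sum>i<m. (\<sigma> g * \<sigma> (inv h)) $$ (i, i))"
        using g h mat_trace_carrier[OF mult_carrier_mat[OF R[OF g] R[OF inv_closed[OF h]]]]
        by (simp add: matrix_rep_mult[OF r] del: index_mult_mat(1))
      then show ?thesis using g h R by (simp add: mat_mult_index[of _ m m _ m] del: index_mult_mat(1))
    qed
    have "(\<Sum>g\<in>carrier G. a (g \<otimes> h) * mat_trace (\<sigma> g)) =
        (\<Sum>g\<in>carrier G. a (g \<otimes> h) * mat_trace (\<sigma> (g \<otimes> h \<otimes> inv h)))"
      using h by (intro sum.cong) (auto simp: m_assoc)
    also have "\<dots> = (\<Sum>g\<in>carrier G. a g * mat_trace (\<sigma> (g \<otimes> inv h)))"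
      by (rule sum.reindex_bij_betw[OF bij_betw_mult_right[OF h]])
    also have "\<dots> = (\<Sum>g\<in>carrier G. \<Sum>i<m. \<Sum>j<m. a g * \<sigma> g $$ (i, j) * \<sigma> (inv h) $$ (j, i))"
      by (simp add: tr sum_distrib_left mult.assoc cong: sum.cong)
    also have "\<dots> = (\<Sum>i<m. \<Sum>j<m. \<Sum>g\<in>carrier G. a g * \<sigma> g $$ (i, j) * \<sigma> (inv h) $$ (j, i))"
      by (subst sum.swap, rule sum.cong[OF refl], rule sum.swap)
    also have "\<dots> = 0" by (simp add: irr[OF s] flip: sum_distrib_right)
    finally show ?thesis .
  qed
  from trace_relation_from_irreducible[OF this \<rho>(1)]
  have "(\<Sum>g\<in>carrier G. a (g \<otimes> h) * mat_trace (\<rho> g)) = 0" .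
  also have "(\<Sum>g\<in>carrier G. a (g \<otimes> h) * mat_trace (\<rho> g)) =
      (\<Sum>g\<in>carrier G. if g = \<one> then a h * of_nat (Coset.order G) else 0)"
    using h by (intro sum.cong) (auto simp: \<rho>(2))
  also have "\<dots> = a h * of_nat (Coset.order G)" using fin by simp
  finally show ?thesis using fin by (auto simp: order_gt_0_iff_finite[symmetric])
qed

end

section \<open>Character degrees and the class structure\<close>

context group
begin

lemma irreducible_rep_trivial: "irreducible_rep G 1 (\<lambda>_. 1\<^sub>m 1)"
  unfolding irreducible_rep_iff
proof (intro conjI allI impI)
  show "matrix_rep G 1 (\<lambda>_. 1\<^sub>m 1)" unfolding matrix_rep_def by simp
  fix W assume W: "VectorSpace.subspace class_ring W (module_vec TYPE(complex) 1) \<and>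
    (\<forall>g\<in>carrier G. \<forall>w\<in>W. 1\<^sub>m 1 *\<^sub>v w \<in> W)"
  then have sub: "submodule class_ring W (module_vec TYPE(complex) 1)" by (simp add: subspace.submod)
  have Wc: "W \<subseteq> carrier_vec 1" and zero: "0\<^sub>v 1 \<in> W"
    using submodule.subset[OF sub] submodule.zero_closed[OF sub] by (simp_all add: module_vec_simps)
  have smult: "c \<cdot>\<^sub>v w \<in> W" if "w \<in> W" for c w
    using submodule.smult_closed[OF sub, of c w] that by (simp add: module_vec_simps)
  show "W = {0\<^sub>v 1} \<or> W = carrier_vec 1"
  proof (cases "W \<subseteq> {0\<^sub>v 1}")
    case True
    then show ?thesis using zero by blast
  next
    case False
    then obtain w where w: "w \<in> W" "w \<noteq> 0\<^sub>v 1" by blast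
    then have wc: "w \<in> carrier_vec 1" using Wc by blast
    then have w0: "w $ 0 \<noteq> 0" using w(2) by (auto intro!: eq_vecI)
    have "v \<in> W" if v: "v \<in> carrier_vec 1" for v
    proof -
      have "v = (v $ 0 / w $ 0) \<cdot>\<^sub>v w" using v wc w0 by (intro eq_vecI) auto
      then show ?thesis using smult[OF w(1)] by metis
    qed
    then show ?thesis using Wc by blast
  qed
qed simp

lemma cd_eq: "cd G = {of_nat n | n. \<exists>\<rho>. irreducible_rep G n \<rho>}"
proof -
  have "(\<lambda>g\<in>carrier G. mat_trace (\<rho> g)) \<one> = of_nat n" if "irreducible_rep G n \<rho>" for n \<rho>
    using matrix_rep_one[OF irreducible_rep_matrix_rep[OF that]] by (simp add: mat_trace_one)
  then show ?thesis unfolding cd_def Irr_def by (auto; metis)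
qed

lemma degree_eq_sqrt_index_iff:
  assumes fin: "finite (carrier G)"
  shows "(of_nat n :: complex) = of_real (sqrt (real (subgroup_index G (center G)))) \<longleftrightarrow>
    card (center G) * n\<^sup>2 = Coset.order G"
proof -
  let ?i = "subgroup_index G (center G)"
  have ZI: "card (center G) * ?i = Coset.order G"
    by (rule card_subgroup_mult_index[OF fin subgroup_center])
  have "Coset.order G > 0" using fin by (simp add: order_gt_0_iff_finite)
  then have Z0: "card (center G) \<noteq> 0" using ZI by (metis mult_0 less_irrefl)
  have "(of_nat n :: complex) = of_real (sqrt (real ?i)) \<longleftrightarrow> real n = sqrt (real ?i)"
    by (metis of_real_eq_iff of_real_of_nat_eq)
  also have "\<dots> \<longleftrightarrow> (real n)\<^sup>2 = real ?i"
    by (metis of_nat_0_le_iff real_sqrt_pow2 real_sqrt_unique)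
  also have "\<dots> \<longleftrightarrow> n\<^sup>2 = ?i" by (metis of_nat_eq_iff of_nat_power)
  also have "\<dots> \<longleftrightarrow> card (center G) * n\<^sup>2 = Coset.order G" unfolding ZI[symmetric] using Z0 by simp
  finally show ?thesis .
qed

lemma index_center_ne_one:
  assumes fin: "finite (carrier G)" and nc: "\<not> comm_group G"
  shows "subgroup_index G (center G) \<noteq> 1"
proof
  assume "subgroup_index G (center G) = 1"
  then have "card (center G) = card (carrier G)"
    using card_subgroup_mult_index[OF fin subgroup_center] by (simp add: Coset.order_def)
  moreover have "center G \<subseteq> carrier G" unfolding center_def by blast
  ultimately have "center G = carrier G" using card_subset_eq[OF fin] by blast
  then have "comm_group G" unfolding center_def by (intro group_comm_groupI) blast
  then show False using nc by simp
qed

text \<open>If all degrees were 1, a commutator \<open>d \<noteq> \<one>\<close> and \<open>\<one>\<close> would have the same image in every irreducible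
  representation.\<close>

lemma exists_nonlinear_irreducible:
  assumes fin: "finite (carrier G)" and nc: "\<not> comm_group G"
  obtains n \<rho> where "irreducible_rep G n \<rho>" "n \<noteq> 1"
proof -
  obtain x y where xy: "x \<in> carrier G" "y \<in> carrier G" "x \<otimes> y \<noteq> y \<otimes> x"
    using nc group_comm_groupI by blast
  let ?d = "commutator G x y"
  have d: "?d \<in> carrier G" "?d \<noteq> \<one>" "?d \<in> commutator_subgroup G"
    using xy commutator_eq_one_iff by auto
  have "\<exists>n \<rho>. irreducible_rep G n \<rho> \<and> n \<noteq> 1"
  proof (rule ccontr)
    assume linear: "\<nexists>n \<rho>. irreducible_rep G n \<rho> \<and> n \<noteq> 1"
    let ?a = "\<lambda>g. of_bool (g = ?d) - of_bool (g = \<one>) :: complex"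
    have "?a ?d = 0"
    proof (rule irreducible_reps_separate[where a = ?a, OF fin _ d(1)])
      fix m \<sigma> and i j :: nat assume s: "irreducible_rep G m \<sigma>" and ij: "i < m" "j < m"
      have m: "m = 1" using linear s by blast
      have same: "\<sigma> ?d = 1\<^sub>m m" "\<sigma> \<one> = 1\<^sub>m m"
        using degree_one_iff_trivial_on_commutator_subgroup[OF s] m d(3)
          matrix_rep_one[OF irreducible_rep_matrix_rep[OF s]] by auto
      have "(\<Sum>g\<in>carrier G. ?a g * \<sigma> g $$ (i, j)) =
          (\<Sum>g\<in>carrier G. if g = ?d then \<sigma> ?d $$ (i, j) else 0) -
          (\<Sum>g\<in>carrier G. if g = \<one> then \<sigma> \<one> $$ (i, j) else 0)"
        unfolding sum_subtractf[symmetric] by (intro sum.cong) auto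
      also have "\<dots> = \<sigma> ?d $$ (i, j) - \<sigma> \<one> $$ (i, j)" using fin d(1) by simp
      finally show "(\<Sum>g\<in>carrier G. ?a g * \<sigma> g $$ (i, j)) = 0" unfolding same by simp
    qed
    then show False using d(2) by simp
  qed
  then show ?thesis using that by blast
qed

text \<open>If \<open>[y, x] = z\<close> is central then \<open>y x y\<inverse> = z x\<close>, and a central element acting by a scalar
  \<open>c \<noteq> 1\<close> forces \<open>\<chi>(x) = c \<chi>(x) = 0\<close>.\<close>

lemma character_vanishes_if_commutators_exhaust:
  assumes irr: "irreducible_rep G n \<rho>" and n: "n \<noteq> 1" and x: "x \<in> carrier G"
    and cen: "commutator_subgroup G \<subseteq> center G"
    and comms: "commutator_subgroup G = {commutator G y x | y. y \<in> carrier G}"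
  shows "mat_trace (\<rho> x) = 0"
proof -
  note r = irreducible_rep_matrix_rep[OF irr]
  note R = matrix_rep_carrier[OF r]
  obtain z where z: "z \<in> commutator_subgroup G" "\<rho> z \<noteq> 1\<^sub>m n"
    using degree_one_iff_trivial_on_commutator_subgroup[OF irr] n by blast
  then obtain y where y: "y \<in> carrier G" "z = commutator G y x" using comms by blast
  obtain c where c: "\<rho> z = c \<cdot>\<^sub>m 1\<^sub>m n" using central_scalar[OF irr] z(1) cen by blast
  have zG: "z \<in> carrier G" using y x by simp
  have "z \<otimes> x = y \<otimes> x \<otimes> inv y" using commutator_mult(2)[OF y(1) x] y(2) by simp
  then have "\<rho> z * \<rho> x = \<rho> y * \<rho> x * \<rho> (inv y)"
    using y(1) x zG matrix_rep_mult[OF r] by (metis inv_closed m_closed)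
  then have "mat_trace (\<rho> z * \<rho> x) = mat_trace (\<rho> x)"
    using mat_trace_conj[OF R[OF x] R[OF inv_closed[OF y(1)]] R[OF y(1)] matrix_rep_inv(2)[OF r y(1)]]
    by simp
  moreover have "\<rho> z * \<rho> x = c \<cdot>\<^sub>m \<rho> x"
    unfolding c using R[OF x] by (simp add: mult_smult_assoc_mat[of _ n n _ n])
  ultimately have "c * mat_trace (\<rho> x) = mat_trace (\<rho> x)" using mat_trace_smult[OF R[OF x]] by simp
  moreover have "c \<noteq> 1" using z(2) unfolding c by (auto simp: smult_one)
  ultimately show ?thesis by simp
qed

text \<open>The sum of \<open>\<rho>\<close> over a normal subgroup \<open>N\<close> is a scalar \<open>c\<close> by Schur's lemma, and multiplication by
  \<open>\<rho> d\<close> with \<open>d\<close> in \<open>N\<close> does not change it; so \<open>c = 0\<close> unless \<open>N\<close> acts trivially.\<close>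

lemma sum_over_normal_subgroup:
  assumes irr: "irreducible_rep G n \<rho>" and N: "N \<lhd> G" and d: "d \<in> N" "\<rho> d \<noteq> 1\<^sub>m n"
  shows "mat_sum n \<rho> N = 0\<^sub>m n n"
proof -
  interpret N: normal N G by (rule N)
  note r = irreducible_rep_matrix_rep[OF irr]
  note R = matrix_rep_carrier[OF r]
  have RN: "\<rho> e \<in> carrier_mat n n" if "e \<in> N" for e using R that by simp
  let ?E = "mat_sum n \<rho> N"
  have "\<rho> h * ?E = ?E * \<rho> h" if h: "h \<in> carrier G" for h
  proof -
    have "\<rho> h * ?E = mat_sum n (\<lambda>e. \<rho> h * \<rho> e) N" by (rule mat_sum_mult_left[OF R[OF h] RN])
    also have "\<dots> = mat_sum n (\<lambda>e. \<rho> (h \<otimes> e \<otimes> inv h) * \<rho> h) N"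
    proof (rule mat_sum_cong)
      fix e assume e: "e \<in> N"
      have "\<rho> (h \<otimes> e \<otimes> inv h) * \<rho> h = \<rho> (h \<otimes> e \<otimes> inv h \<otimes> h)"
        using h e by (simp add: matrix_rep_mult[OF r])
      also have "h \<otimes> e \<otimes> inv h \<otimes> h = h \<otimes> e" using h e by (simp add: m_assoc)
      finally show "\<rho> h * \<rho> e = \<rho> (h \<otimes> e \<otimes> inv h) * \<rho> h" using h e by (simp add: matrix_rep_mult[OF r])
    qed
    also have "\<dots> = mat_sum n (\<lambda>e. \<rho> e * \<rho> h) N"
      by (rule mat_sum_reindex[OF bij_betw_conj_normal[OF N h], of n "\<lambda>e. \<rho> e * \<rho> h"])
    also have "\<dots> = ?E * \<rho> h" by (rule mat_sum_mult_right[OF R[OF h] RN, symmetric])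
    finally show ?thesis .
  qed
  then obtain c where c: "?E = c \<cdot>\<^sub>m 1\<^sub>m n" using schur[OF irr mat_sum_carrier] by metis
  have dG: "d \<in> carrier G" using d(1) by simp
  have "\<rho> d * ?E = mat_sum n (\<lambda>e. \<rho> d * \<rho> e) N" by (rule mat_sum_mult_left[OF R[OF dG] RN])
  also have "\<dots> = mat_sum n (\<lambda>e. \<rho> (d \<otimes> e)) N"
    by (rule mat_sum_cong) (simp add: matrix_rep_mult[OF r dG])
  also have "\<dots> = ?E"
  proof (rule mat_sum_reindex)
    show "bij_betw (\<lambda>e. d \<otimes> e) N N"
      by (rule bij_betwI[of _ _ _ "\<lambda>e. inv d \<otimes> e"]) (use d(1) dG in auto)
  qed
  finally have "c \<cdot>\<^sub>m \<rho> d = c \<cdot>\<^sub>m 1\<^sub>m n"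
    unfolding c using R[OF dG] by (simp add: mult_smult_distrib[of _ n n _ n])
  have "c = 0"
  proof (rule ccontr)
    assume "c \<noteq> 0"
    have "\<rho> d = inverse c \<cdot>\<^sub>m (c \<cdot>\<^sub>m \<rho> d)" using \<open>c \<noteq> 0\<close> by (intro eq_matI) auto
    also have "\<dots> = inverse c \<cdot>\<^sub>m (c \<cdot>\<^sub>m 1\<^sub>m n)" by (simp only: \<open>c \<cdot>\<^sub>m \<rho> d = c \<cdot>\<^sub>m 1\<^sub>m n\<close>)
    also have "\<dots> = 1\<^sub>m n" using \<open>c \<noteq> 0\<close> by (intro eq_matI) auto
    finally show False using d(2) by simp
  qed
  then show ?thesis unfolding c by (intro eq_matI) auto
qed

text \<open>The normalized sums over the coset \<open>G' x\<close> and over the class of \<open>x\<close> have the same image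
  in every irreducible representation: both act as \<open>\<rho> x\<close> in degree 1, and both vanish in the other
  degrees, the second one because \<open>\<chi>(x) = 0\<close>. Hence they agree in the group algebra.\<close>

lemma conj_class_eq_coset_if_characters_vanish:
  assumes fin: "finite (carrier G)" and x: "x \<in> carrier G"
    and vanish: "\<And>n \<rho>. irreducible_rep G n \<rho> \<Longrightarrow> n \<noteq> 1 \<Longrightarrow> mat_trace (\<rho> x) = 0"
  shows "conj_class G x = commutator_subgroup G #> x"
proof
  let ?D = "commutator_subgroup G" and ?k = "\<lambda>g. g \<otimes> x \<otimes> inv g"
  let ?N = "of_nat (Coset.order G) :: complex"
  have finD: "finite ?D" using fin commutator_subgroup_subset finite_subset by blast
  have k: "?k g \<in> carrier G" if "g \<in> carrier G" for g using that x by simp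
  have dx: "d \<otimes> x \<in> carrier G" if "d \<in> ?D" for d using that x commutator_subgroup_subset by auto
  \<comment> \<open>\<open>|G| |G'|\<close> times the difference of the two normalized sums\<close>
  define a where "a y = ?N * (\<Sum>d\<in>?D. of_bool (d \<otimes> x = y)) -
    of_nat (card ?D) * (\<Sum>g\<in>carrier G. of_bool (?k g = y))" for y
  have a_sum: "(\<Sum>y\<in>carrier G. a y * f y) =
      ?N * (\<Sum>d\<in>?D. f (d \<otimes> x)) - of_nat (card ?D) * (\<Sum>g\<in>carrier G. f (?k g))"
    for f :: "'a \<Rightarrow> complex"
  proof -
    have fibre: "(\<Sum>y\<in>carrier G. (\<Sum>s\<in>S. of_bool (u s = y)) * f y) = (\<Sum>s\<in>S. f (u s))"
      if "\<And>s. s \<in> S \<Longrightarrow> u s \<in> carrier G" for S and u :: "'a \<Rightarrow> 'a"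
    proof -
      have "(\<Sum>y\<in>carrier G. (\<Sum>s\<in>S. of_bool (u s = y)) * f y) =
          (\<Sum>s\<in>S. \<Sum>y\<in>carrier G. if y = u s then f (u s) else 0)"
        unfolding sum_distrib_right by (subst sum.swap) (auto intro!: sum.cong)
      then show ?thesis using that fin by simp
    qed
    have "(\<Sum>y\<in>carrier G. a y * f y) =
        ?N * (\<Sum>y\<in>carrier G. (\<Sum>d\<in>?D. of_bool (d \<otimes> x = y)) * f y) -
        of_nat (card ?D) * (\<Sum>y\<in>carrier G. (\<Sum>g\<in>carrier G. of_bool (?k g = y)) * f y)"
      unfolding a_def left_diff_distrib sum_subtractf mult.assoc sum_distrib_left[symmetric] ..
    then show ?thesis using fibre[of ?D "\<lambda>d. d \<otimes> x"] fibre[of "carrier G" ?k] dx k by simp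
  qed
  show "conj_class G x \<subseteq> ?D #> x" by (rule conj_class_subset_coset[OF x])
  show "?D #> x \<subseteq> conj_class G x"
  proof
    fix y assume y: "y \<in> ?D #> x"
    then obtain d where d: "d \<in> ?D" "y = d \<otimes> x" unfolding r_coset_def by blast
    have "a y = 0"
    proof (rule irreducible_reps_separate[OF fin])
      show "y \<in> carrier G" using d dx by simp
      fix n \<rho> and i j :: nat assume irr: "irreducible_rep G n \<rho>" and ij: "i < n" "j < n"
      note r = irreducible_rep_matrix_rep[OF irr]
      note R = matrix_rep_carrier[OF r]
      show "(\<Sum>g\<in>carrier G. a g * \<rho> g $$ (i, j)) = 0"
      proof (cases "n = 1")
        case True
        have triv: "\<rho> (e \<otimes> x) = \<rho> x" if e: "e \<in> ?D" for e
        proof -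
          have "\<rho> e = 1\<^sub>m n"
            using degree_one_iff_trivial_on_commutator_subgroup[OF irr] True e by blast
          moreover have "e \<in> carrier G" using e commutator_subgroup_subset by blast
          ultimately show ?thesis using x matrix_rep_mult[OF r] R[OF x] by simp
        qed
        have "\<rho> (?k g) = \<rho> x" if g: "g \<in> carrier G" for g
          using triv[OF commutator_in_commutator_subgroup[OF g x]] commutator_mult(2)[OF g x] by simp
        then show ?thesis unfolding a_sum by (simp add: triv Coset.order_def)
      next
        case False
        then obtain e where "e \<in> ?D" "\<rho> e \<noteq> 1\<^sub>m n"
          using degree_one_iff_trivial_on_commutator_subgroup[OF irr] by blast
        from sum_over_normal_subgroup[OF irr normal_commutator_subgroup this]
        have "mat_sum n \<rho> ?D * \<rho> x = 0\<^sub>m n n" using R[OF x] by simp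
        moreover have "mat_sum n \<rho> ?D * \<rho> x = mat_sum n (\<lambda>d. \<rho> d * \<rho> x) ?D"
          by (rule mat_sum_mult_right[OF R[OF x]]) (use R commutator_subgroup_subset in blast)
        moreover have "\<dots> = mat_sum n (\<lambda>d. \<rho> (d \<otimes> x)) ?D"
          by (rule mat_sum_cong) (use commutator_subgroup_subset x matrix_rep_mult[OF r] in auto)
        ultimately have "mat_sum n (\<lambda>d. \<rho> (d \<otimes> x)) ?D $$ (i, j) = 0" using ij by simp
        then have coset: "(\<Sum>d\<in>?D. \<rho> (d \<otimes> x) $$ (i, j)) = 0" using ij by (simp add: mat_sum_index)
        have "mat_sum n (\<lambda>g. \<rho> (?k g)) (carrier G) $$ (i, j) = 0"
          unfolding class_sum_scalar[OF irr x] using vanish[OF irr False] ij by simp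
        then have "(\<Sum>g\<in>carrier G. \<rho> (?k g) $$ (i, j)) = 0" using ij by (simp add: mat_sum_index)
        then show ?thesis unfolding a_sum coset by simp
      qed
    qed
    moreover have "(\<Sum>e\<in>?D. of_bool (e \<otimes> x = y)) = (1 :: complex)"
    proof -
      have "(\<Sum>e\<in>?D. of_bool (e \<otimes> x = y)) = (\<Sum>e\<in>?D. if e = d then 1 else 0 :: complex)"
        using commutator_subgroup_subset d x by (intro sum.cong) (auto simp: subset_iff)
      then show ?thesis using finD d(1) by simp
    qed
    ultimately have nonzero: "(\<Sum>g\<in>carrier G. of_bool (?k g = y)) \<noteq> (0 :: complex)"
      unfolding a_def using order_gt_0_iff_finite fin by (metis mult_zero_right diff_zero mult_eq_0_iff
        of_nat_eq_0_iff one_neq_zero less_irrefl)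
    show "y \<in> conj_class G x"
    proof (rule ccontr)
      assume "y \<notin> conj_class G x"
      then have "?k g \<noteq> y" if "g \<in> carrier G" for g using that unfolding conj_class_eq by blast
      then have "(\<Sum>g\<in>carrier G. of_bool (?k g = y)) = (0 :: complex)" by (intro sum.neutral) auto
      then show False using nonzero by contradiction
    qed
  qed
qed

lemma cd_eq_iff_conj_class_eq_coset:
  assumes fin: "finite (carrier G)" and nc: "\<not> comm_group G"
  shows "cd G = {1, complex_of_real (sqrt (real (subgroup_index G (center G))))} \<longleftrightarrow>
    (\<forall>x\<in>carrier G - center G. conj_class G x = commutator_subgroup G #> x)"
    (is "cd G = {1, ?s} \<longleftrightarrow> ?d")
proof
  assume b: "cd G = {1, ?s}"
  show ?d
  proof
    fix x assume x: "x \<in> carrier G - center G"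
    show "conj_class G x = commutator_subgroup G #> x"
    proof (rule conj_class_eq_coset_if_characters_vanish[OF fin])
      show "x \<in> carrier G" using x by blast
      fix n \<rho> assume irr: "irreducible_rep G n \<rho>" and n: "n \<noteq> 1"
      have "of_nat n \<in> cd G" using irr unfolding cd_eq by blast
      then have "of_nat n = ?s" using n unfolding b by (auto simp: of_nat_eq_1_iff)
      then have "card (center G) * n\<^sup>2 = Coset.order G" using degree_eq_sqrt_index_iff[OF fin] by simp
      then show "mat_trace (\<rho> x) = 0" by (rule character_vanishes_off_center[OF fin irr _ x])
    qed
  qed
next
  assume d: ?d
  have cen: "commutator_subgroup G \<subseteq> center G" using commutator_subgroup_central d by blast
  have deg: "of_nat n = ?s" if irr: "irreducible_rep G n \<rho>" and n: "n \<noteq> 1" for n \<rho>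
  proof -
    have "mat_trace (\<rho> x) = 0" if x: "x \<in> carrier G - center G" for x
    proof (rule character_vanishes_if_commutators_exhaust[OF irr n _ cen])
      show xG: "x \<in> carrier G" using x by blast
      show "commutator_subgroup G = {commutator G y x | y. y \<in> carrier G}"
        using conj_class_eq_coset_iff[OF xG] d x by blast
    qed
    then have "of_nat (card (center G)) * (of_nat n)\<^sup>2 = (of_nat (Coset.order G) :: complex)"
      using character_norm_off_center[OF fin irr] by simp
    then have "card (center G) * n\<^sup>2 = Coset.order G" by (metis of_nat_eq_iff of_nat_mult of_nat_power)
    then show ?thesis using degree_eq_sqrt_index_iff[OF fin] by simp
  qed
  obtain n \<rho> where "irreducible_rep G n \<rho>" "n \<noteq> 1" by (rule exists_nonlinear_irreducible[OF fin nc])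
  then have "?s \<in> cd G" using deg unfolding cd_eq by force
  moreover have "1 \<in> cd G" using irreducible_rep_trivial unfolding cd_eq by force
  moreover have "cd G \<subseteq> {1, ?s}"
  proof
    fix c assume "c \<in> cd G"
    then obtain n \<rho> where "c = of_nat n" "irreducible_rep G n \<rho>" unfolding cd_eq by blast
    then show "c \<in> {1, ?s}" using deg[of n \<rho>] by (cases "n = 1") auto
  qed
  ultimately show "cd G = {1, ?s}" by blast
qed

lemma cd_eq_iff_central_type:
  assumes fin: "finite (carrier G)" and nc: "\<not> comm_group G"
  shows "cd G = {1, complex_of_real (sqrt (real (subgroup_index G (center G))))} \<longleftrightarrow>
    central_type G \<and> card (cd G) = 2" (is "cd G = {1, ?s} \<longleftrightarrow> _")
proof -
  have s: "?s \<noteq> 1" using index_center_ne_one[OF fin nc] by simp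
  have ct: "central_type G \<longleftrightarrow> ?s \<in> cd G" unfolding central_type_def cd_def Bex_def mem_Collect_eq
    by (intro ex_cong1) auto
  have one: "1 \<in> cd G" using irreducible_rep_trivial unfolding cd_eq by force
  show ?thesis
  proof
    assume "cd G = {1, ?s}"
    then show "central_type G \<and> card (cd G) = 2" using ct s by simp
  next
    assume *: "central_type G \<and> card (cd G) = 2"
    have "{1, ?s} = cd G"
    proof (rule card_subset_eq)
      show "finite (cd G)" using * by (simp add: card_ge_0_finite)
      show "{1, ?s} \<subseteq> cd G" using * ct one by blast
      show "card {1, ?s} = card (cd G)" using * s by simp
    qed
    then show "cd G = {1, ?s}" by simp
  qed
qed

lemma conj_class_eq_coset_iff_centralizer_quotient:
  assumes fin: "finite (carrier G)"
  shows "(\<forall>x\<in>carrier G - center G. conj_class G x = commutator_subgroup G #> x) \<longleftrightarrow>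
    (\<forall>x\<in>carrier G - center G. centralizer G x \<lhd> G \<and>
      G\<lparr>carrier := commutator_subgroup G\<rparr> \<cong> G Mod (centralizer G x))" (is "?d \<longleftrightarrow> ?e")
proof
  assume d: ?d
  have cen: "commutator_subgroup G \<subseteq> center G" using commutator_subgroup_central d by blast
  show ?e
  proof
    fix x assume x: "x \<in> carrier G - center G"
    then have xG: "x \<in> carrier G" by blast
    have "commutator_subgroup G = {commutator G y x | y. y \<in> carrier G}"
      using conj_class_eq_coset_iff[OF xG] d x by blast
    then show "centralizer G x \<lhd> G \<and>
        G\<lparr>carrier := commutator_subgroup G\<rparr> \<cong> G Mod (centralizer G x)"
      using commutator_subgroup_iso_centralizer_quotient[OF xG cen] by blast
  qed
next
  assume e: ?e
  show ?d
  proof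
    fix x assume x: "x \<in> carrier G - center G"
    then have xG: "x \<in> carrier G" by blast
    have "G\<lparr>carrier := commutator_subgroup G\<rparr> \<cong> G Mod (centralizer G x)" using e x by blast
    then have "card (commutator_subgroup G) = card (carrier (G Mod (centralizer G x)))"
      using iso_same_card by fastforce
    also have "\<dots> = card (conj_class G x)"
      using index_centralizer[OF xG] unfolding subgroup_index_def by (simp add: FactGroup_def)
    finally show "conj_class G x = commutator_subgroup G #> x"
      using card_conj_class_eq_iff[OF fin xG] by simp
  qed
qed

lemma CN_group_iff_noncentral:
  "CN_group G \<longleftrightarrow> (\<forall>x\<in>carrier G - center G. centralizer G x \<lhd> G)"
proof -
  have "centralizer G x = carrier G" if "x \<in> center G" for x
    using that unfolding center_def centralizer_def by auto
  moreover have "carrier G \<lhd> G" by (rule normal_self)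
  ultimately show ?thesis unfolding CN_group_def using is_group
    by (metis Diff_iff)
qed

end

theorem theorem2p4p3:
  fixes G :: "('a, 'b) monoid_scheme"
  assumes "group G" and "finite (carrier G)" and "\<not> comm_group G"
  shows
    "let Z = center G;
         D = commutator_subgroup G;
         a = (commuting_probability G =
                1 / real (card D) * (1 + (real (card D) - 1) / real (subgroup_index G Z)));
         b = (cd G = {1, complex_of_real (sqrt (real (subgroup_index G Z)))});
         c = (\<forall>x\<in>carrier G - Z. card (conj_class G x) = card D);
         d = (\<forall>x\<in>carrier G - Z. conj_class G x = D #>\<^bsub>G\<^esub> x);
         e = (\<forall>x\<in>carrier G - Z. centralizer G x \<lhd> G \<and>
                G\<lparr>carrier := D\<rparr> \<cong> G Mod (centralizer G x));
         f = (\<forall>x\<in>carrier G - Z. D = {commutator G y x | y. y \<in> carrier G})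
     in (a \<longleftrightarrow> b) \<and> (a \<longleftrightarrow> c) \<and> (a \<longleftrightarrow> d) \<and> (a \<longleftrightarrow> e) \<and> (a \<longleftrightarrow> f) \<and>
        (b \<longleftrightarrow> central_type G \<and> card (cd G) = 2) \<and>
        (d \<longrightarrow> nilpotent_of_class G 2) \<and>
        (e \<longrightarrow> CN_group G) \<and>
        (f \<longrightarrow> (\<forall>z\<in>D. \<exists>x\<in>carrier G. \<exists>y\<in>carrier G. z = commutator G x y))"
proof -
  interpret group G by fact
  note fin = assms(2) and nc = assms(3)
  let ?Z = "center G" and ?D = "commutator_subgroup G"
  let ?d = "\<forall>x\<in>carrier G - ?Z. conj_class G x = ?D #>\<^bsub>G\<^esub> x"
  let ?f = "\<forall>x\<in>carrier G - ?Z. ?D = {commutator G y x | y. y \<in> carrier G}"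
  have cd: "(\<forall>x\<in>carrier G - ?Z. card (conj_class G x) = card ?D) \<longleftrightarrow> ?d"
    using card_conj_class_eq_iff[OF fin] by (intro ball_cong) auto
  have fd: "?f \<longleftrightarrow> ?d" using conj_class_eq_coset_iff by (intro ball_cong) blast+
  have "nilpotent_of_class G 2" if ?d
    using nilpotent_of_class_2[OF nc] commutator_subgroup_central that by blast
  moreover obtain x where x: "x \<in> carrier G - ?Z"
  proof -
    obtain x y where "x \<in> carrier G" "y \<in> carrier G" "x \<otimes>\<^bsub>G\<^esub> y \<noteq> y \<otimes>\<^bsub>G\<^esub> x"
      using nc group_comm_groupI by blast
    then show thesis using that unfolding center_def by blast
  qed
  have "\<forall>z\<in>?D. \<exists>x\<in>carrier G. \<exists>y\<in>carrier G. z = commutator G x y" if ?f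
    using that x by blast
  ultimately show ?thesis
    unfolding Let_def commuting_probability_eq_iff[OF fin] cd fd
      cd_eq_iff_central_type[OF fin nc, symmetric] cd_eq_iff_conj_class_eq_coset[OF fin nc]
      conj_class_eq_coset_iff_centralizer_quotient[OF fin, symmetric]
    using conj_class_eq_coset_iff_centralizer_quotient[OF fin] CN_group_iff_noncentral by blast
qed

end
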